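(* Let $\mu_0,\mu_T\in\mathcal{P}(\mathbb{R}^d)$ and let $\gamma\in\Pi$, where $\Pi$ is the set of Borel probability measures on $\mathbb{R}^d\times\mathbb{R}^d$ with first marginal $\mu_0$ and second marginal $\mu_T$. Suppose $S:\mathbb{R}^d\times\mathbb{R}^d\to\Omega$ is a measurable map, defined $\gamma$-almost everywhere, such that $$S^\omega_0(x,y)=x,\qquad S^\omega_T(x,y)=y$$ for $\gamma$-almost every $(x,y)\in\mathbb{R}^d\times\mathbb{R}^d$. Then there exists $\eta\in\mathcal{Y}^{\mu_T}_{\mu_0}(I\times\mathbb{R}^d\times U)$.
   Context: Let $d,n\ge1$, $T>0$, $I=[0,T]$, $p\ge1$, $U\subseteq\mathbb{R}^n$ (the control set), $f_0,\dots,f_n:\mathbb{R}^d\to\mathbb{R}^d$ smooth vector fields, and $f(x,u)=f_0(x)+\sum_{i=1}^n u_i f_i(x)$. Let $\mathcal{U}=\{u\in L^p(0,T;\mathbb{R}^n): u(t)\in U\text{ for a.e. }t\}$ and let $\Omega$ be the set of pairs $(\omega,u)\in C([0,T];\mathbb{R}^d)\times\mathcal{U}$ satisfying $\dot\omega(t)=f(\omega(t),u(t))$ for a.e. $t$. For a map $S$ into $\Omega$ with $S(x,y)=(\ell,\alpha)$, write $S^\omega_t(x,y)=\ell(t)$ and $S^u_t(x,y)=\alpha(t)$. $\mathcal{P}(X)$ denotes the Borel probability measures on $X$. $\mathcal{Y}(I\times\mathbb{R}^d\times U)$ is the set of nonnegative Borel measures $K$ on $I\times\mathbb{R}^d\times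 U$ whose image under $(t,x,u)\mapsto t$ is Lebesgue measure on $I$. $\mathcal{Y}^{\mu_T}_{\mu_0}(I\times\mathbb{R}^d\times U)$ is the set of those $K\in\mathcal{Y}(I\times\mathbb{R}^d\times U)$ such that for all $\phi\in C^1_c(I\times\mathbb{R}^d)$ $$\int_{I\times\mathbb{R}^d\times U}[\partial_t\phi+\partial_x\phi\cdot f(x,u)]\,dK(t,x,u)=\int\phi(T,x)\,d\mu_T(x)-\int\phi(0,x)\,d\mu_0(x).$$
   Formalization: Paths in Ω are taken absolutely continuous, and it is additionally assumed that for each test function φ the integral of |∂_tφ+∂_xφ·f| along the trajectories S(x,y), over [0,T] and γ, is finite (automatic for bounded U); without this the claim fails for unbounded U. *)

theory Defs
  imports "HOL-Analysis.Analysis" "HOL-Probability.Probability"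
begin

section \<open>The control system\<close>

primrec Ck :: "nat \<Rightarrow> ('a::real_normed_vector \<Rightarrow> 'b::real_normed_vector) \<Rightarrow> bool" where
  "Ck 0 g \<longleftrightarrow> continuous_on UNIV g"
| "Ck (Suc k) g \<longleftrightarrow> (\<forall>x. g differentiable (at x)) \<and>
     (\<forall>v. Ck k (\<lambda>x. frechet_derivative g (at x) v))"

definition smooth :: "('a::real_normed_vector \<Rightarrow> 'b::real_normed_vector) \<Rightarrow> bool" where
  "smooth g \<longleftrightarrow> (\<forall>k. Ck k g)"

definition control_field ::
    "(real^'d \<Rightarrow> real^'d) \<Rightarrow> ('n \<Rightarrow> real^'d \<Rightarrow> real^'d) \<Rightarrow> real^'d \<Rightarrow> real^'n \<Rightarrow> real^'d" where
  "control_field f0 fs x u = f0 x + (\<Sum>i\<in>UNIV. (u $ i) *\<^sub>R fs i x)"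

definition absolutely_continuous_path :: "real \<Rightarrow> (real \<Rightarrow> real^'d) \<Rightarrow> bool" where
  "absolutely_continuous_path T \<omega> \<longleftrightarrow>
     (\<forall>e>0. \<exists>\<delta>>0. \<forall>J. finite J \<longrightarrow>
        (\<forall>(a,b)\<in>J. 0 \<le> a \<and> a \<le> b \<and> b \<le> T) \<longrightarrow>
        pairwise (\<lambda>(a,b) (a',b'). {a<..<b} \<inter> {a'<..<b'} = {}) J \<longrightarrow>
        (\<Sum>(a,b)\<in>J. b - a) < \<delta> \<longrightarrow>
        (\<Sum>(a,b)\<in>J. norm (\<omega> b - \<omega> a)) < e)"

text \<open>Elements of \<open>L\<^sup>p(0,T)\<close> and of \<open>C([0,T])\<close> are represented by functions on \<open>real\<close>. Nothing below
  depends on their values outside \<open>[0,T]\<close>, nor on the choice of the representative of an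
  \<open>L\<^sup>p\<close> class.\<close>

definition controls :: "real \<Rightarrow> real \<Rightarrow> (real^'n) set \<Rightarrow> (real \<Rightarrow> real^'n) set" where
  "controls T p U =
     {u. u \<in> borel_measurable (lebesgue_on {0..T}) \<and>
         integrable (lebesgue_on {0..T}) (\<lambda>t. norm (u t) powr p) \<and>
         (AE t in lebesgue_on {0..T}. u t \<in> U)}"

definition Lp_dist :: "real \<Rightarrow> real \<Rightarrow> (real \<Rightarrow> real^'n) \<Rightarrow> (real \<Rightarrow> real^'n) \<Rightarrow> real" where
  "Lp_dist T p u v = (\<integral>t. norm (u t - v t) powr p \<partial>lebesgue_on {0..T}) powr (1 / p)"

text \<open>The equation \<open>\<omega>' = f(\<omega>,u)\<close> a.e. is meant in the sense of Caratheodory, that is, for absolutely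
  continuous \<open>\<omega>\<close>; otherwise a Cantor function would solve \<open>\<omega>' = 0\<close>.\<close>

definition trajectories ::
    "real \<Rightarrow> real \<Rightarrow> (real^'n) set \<Rightarrow> (real^'d \<Rightarrow> real^'n \<Rightarrow> real^'d)
      \<Rightarrow> ((real \<Rightarrow> real^'d) \<times> (real \<Rightarrow> real^'n)) set" where
  "trajectories T p U f =
     {(\<omega>, u). continuous_on {0..T} \<omega> \<and> u \<in> controls T p U \<and>
        absolutely_continuous_path T \<omega> \<and>
        (AE t in lebesgue_on {0..T}.
           (\<omega> has_vector_derivative f (\<omega> t) (u t)) (at t within {0..T}))}"

text \<open>The Borel \<open>\<sigma>\<close>-algebra on the set of trajectories for the topology induced by
  \<open>C([0,T]) \<times> L\<^sup>p(0,T)\<close> (uniform norm and \<open>L\<^sup>p\<close> norm).\<close>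

definition trajectories_open ::
    "real \<Rightarrow> real \<Rightarrow> (real^'n) set \<Rightarrow> (real^'d \<Rightarrow> real^'n \<Rightarrow> real^'d)
      \<Rightarrow> ((real \<Rightarrow> real^'d) \<times> (real \<Rightarrow> real^'n)) set \<Rightarrow> bool" where
  "trajectories_open T p U f V \<longleftrightarrow> V \<subseteq> trajectories T p U f \<and>
     (\<forall>(\<omega>, u)\<in>V. \<exists>e>0. \<forall>(\<omega>', u')\<in>trajectories T p U f.
        (\<forall>t\<in>{0..T}. dist (\<omega>' t) (\<omega> t) < e) \<and> Lp_dist T p u' u < e \<longrightarrow> (\<omega>', u') \<in> V)"

definition trajectories_borel ::
    "real \<Rightarrow> real \<Rightarrow> (real^'n) set \<Rightarrow> (real^'d \<Rightarrow> real^'n \<Rightarrow> real^'d)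
      \<Rightarrow> ((real \<Rightarrow> real^'d) \<times> (real \<Rightarrow> real^'n)) measure" where
  "trajectories_borel T p U f =
     sigma (trajectories T p U f) {V. trajectories_open T p U f V}"

abbreviation state_at ::
    "('z \<Rightarrow> (real \<Rightarrow> 'a) \<times> (real \<Rightarrow> 'b)) \<Rightarrow> real \<Rightarrow> 'z \<Rightarrow> 'a" where
  "state_at S t z \<equiv> fst (S z) t"

abbreviation control_at ::
    "('z \<Rightarrow> (real \<Rightarrow> 'a) \<times> (real \<Rightarrow> 'b)) \<Rightarrow> real \<Rightarrow> 'z \<Rightarrow> 'b" where
  "control_at S t z \<equiv> snd (S z) t"

section \<open>Measures\<close>

definition borel_probs :: "'a::topological_space measure set" where
  "borel_probs = {\<mu>. prob_space \<mu> \<and> sets \<mu> = sets borel}"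

definition couplings ::
    "(real^'d) measure \<Rightarrow> (real^'d) measure \<Rightarrow> ((real^'d) \<times> (real^'d)) measure set" where
  "couplings \<mu>0 \<mu>T =
     {\<gamma>\<in>borel_probs. distr \<gamma> borel fst = \<mu>0 \<and> distr \<gamma> borel snd = \<mu>T}"

definition young_measures ::
    "real \<Rightarrow> (real^'n) set \<Rightarrow> (real \<times> (real^'d) \<times> (real^'n)) measure set" where
  "young_measures T U =
     {K. sets K = sets (restrict_space borel ({0..T} \<times> UNIV \<times> U)) \<and>
         distr K (restrict_space borel {0..T}) fst = restrict_space lborel {0..T}}"

text \<open>\<open>C\<^sup>1\<^sub>c\<close> functions on \<open>[0,T] \<times> \<real>\<^sup>d\<close>, with one-sided time derivatives at \<open>t = 0\<close> and \<open>t = T\<close>;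
  the support need not avoid the end times.\<close>

definition dtest ::
    "real \<Rightarrow> (real \<times> (real^'d) \<Rightarrow> real) \<Rightarrow> real \<times> (real^'d) \<Rightarrow> real \<times> (real^'d) \<Rightarrow> real" where
  "dtest T \<phi> q = frechet_derivative \<phi> (at q within {0..T} \<times> UNIV)"

definition C1c :: "real \<Rightarrow> (real \<times> (real^'d) \<Rightarrow> real) set" where
  "C1c T = {\<phi>. \<phi> differentiable_on ({0..T} \<times> UNIV) \<and>
               (\<forall>v. continuous_on ({0..T} \<times> UNIV) (\<lambda>q. dtest T \<phi> q v)) \<and>
               compact (closure {q \<in> {0..T} \<times> UNIV. \<phi> q \<noteq> 0})}"

text \<open>The first summand is \<open>\<partial>\<^sub>t\<phi>(t,x)\<close>, the second is \<open>\<partial>\<^sub>x\<phi>(t,x) \<cdot> f(x,u)\<close>.\<close>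

definition transport_integrand ::
    "real \<Rightarrow> (real^'d \<Rightarrow> real^'n \<Rightarrow> real^'d) \<Rightarrow> (real \<times> (real^'d) \<Rightarrow> real)
      \<Rightarrow> real \<times> (real^'d) \<times> (real^'n) \<Rightarrow> real" where
  "transport_integrand T f \<phi> =
     (\<lambda>(t, x, u). dtest T \<phi> (t, x) (1, 0) + dtest T \<phi> (t, x) (0, f x u))"

text \<open>Since the Bochner integral of a non-integrable function is \<open>0\<close> by convention, the existence of
  the integral on the left-hand side is stated explicitly.\<close>

definition admissible_young_measures ::
    "real \<Rightarrow> (real^'n) set \<Rightarrow> (real^'d \<Rightarrow> real^'n \<Rightarrow> real^'d) \<Rightarrow> (real^'d) measure \<Rightarrow> (real^'d) measure
      \<Rightarrow> (real \<times> (real^'d) \<times> (real^'n)) measure set" where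
  "admissible_young_measures T U f \<mu>0 \<mu>T =
     {K \<in> young_measures T U. \<forall>\<phi>\<in>C1c T.
        integrable K (transport_integrand T f \<phi>) \<and>
        (\<integral>y. transport_integrand T f \<phi> y \<partial>K) = (\<integral>x. \<phi> (T, x) \<partial>\<mu>T) - (\<integral>x. \<phi> (0, x) \<partial>\<mu>0)}"

text \<open>Existence of the integral of \<open>\<partial>\<^sub>t\<phi> + \<partial>\<^sub>x\<phi> \<cdot> f\<close> along a random trajectory drawn by \<open>\<gamma>\<close>. As \<open>\<phi>\<close> has
  compact support, this is local in the state variable, and it is automatic when \<open>U\<close> is bounded.
  For unbounded \<open>U\<close> it does not follow from \<open>S\<close> having values in \<open>C \<times> L\<^sup>p\<close>. The integral is
  iterated because the representatives of the controls need not be jointly measurable.\<close>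

definition transport_integrable_along ::
    "real \<Rightarrow> (real^'d \<Rightarrow> real^'n \<Rightarrow> real^'d) \<Rightarrow> 'z measure \<Rightarrow> 'z set
      \<Rightarrow> ('z \<Rightarrow> (real \<Rightarrow> real^'d) \<times> (real \<Rightarrow> real^'n)) \<Rightarrow> bool" where
  "transport_integrable_along T f \<gamma> D S \<longleftrightarrow>
     (\<forall>\<phi>\<in>C1c T.
        (\<integral>\<^sup>+z\<in>D. (\<integral>\<^sup>+t. ennreal \<bar>transport_integrand T f \<phi> (t, state_at S t z, control_at S t z)\<bar>
            \<partial>lebesgue_on {0..T}) \<partial>\<gamma>) < \<infinity>)"

end

theory Submission
  imports Defs
begin

text \<open>The measure sought is the occupation measure \<open>\<eta> = \<integral> (\<integral>\<^sub>0\<^sup>T \<delta>\<^bsub>(t, \<omega>\<^sub>z(t), u\<^sub>z(t))\<^esub> dt) d\<gamma>(z)\<close> of the random trajectory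
  \<open>(\<omega>\<^sub>z, u\<^sub>z) = S z\<close>. It is well defined because \<open>(\<omega>, u) \<mapsto> \<integral> g(t, \<omega>(t), u(t)) dt\<close> is continuous on
  \<open>C \<times> L\<^sup>p\<close> for bounded Lipschitz \<open>g\<close>, hence Borel measurable when \<open>g\<close> is the indicator of an open set.
  Along one trajectory \<open>\<partial>\<^sub>t\<phi> + \<partial>\<^sub>x\<phi> \<cdot> f\<close> is almost everywhere the derivative of the absolutely continuous
  function \<open>\<phi> (t, \<omega> t)\<close>, so it integrates to \<open>\<phi> (T, y) - \<phi> (0, x)\<close>; averaging over \<open>\<gamma>\<close> and using its
  marginals gives the transport equation.\<close>

section \<open>Absolutely continuous functions\<close>

text \<open>Two obstacles shape the construction. Measurability in \<open>z\<close> is therefore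
  extracted from integrals over \<open>t\<close>, which do not see the choice of representative:
  first for open sets, then for all sets through an intersection-stable generator. Time thus becomes
  a probability kernel, and \<open>bind\<close> does the averaging. Moreover \<open>U\<close> is an
  arbitrary set, so the target carries the trace of the Borel sets, and a control may leave
  \<open>U\<close> on a null set of times. The integrability hypothesis serves the averaging: it
  makes the signed integral against the occupation measure equal to the iterated one. Along a single
  trajectory the fundamental theorem of calculus is proved for the gauge integral, where
  integrability of the derivative is part of the conclusion.\<close>

text \<open>As \<open>absolutely_continuous_path\<close>, for an arbitrary codomain: real functions \<open>\<phi> (t, \<omega> t)\<close> are needed too.\<close>

definition absolutely_continuous_Icc :: "real \<Rightarrow> real \<Rightarrow> (real \<Rightarrow> 'a::real_normed_vector) \<Rightarrow> bool" where
  "absolutely_continuous_Icc a b h \<longleftrightarrow>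
     (\<forall>e>0. \<exists>\<delta>>0. \<forall>J. finite J \<longrightarrow>
        (\<forall>(c,d)\<in>J. a \<le> c \<and> c \<le> d \<and> d \<le> b) \<longrightarrow>
        pairwise (\<lambda>(c,d) (c',d'). {c<..<d} \<inter> {c'<..<d'} = {}) J \<longrightarrow>
        (\<Sum>(c,d)\<in>J. d - c) < \<delta> \<longrightarrow>
        (\<Sum>(c,d)\<in>J. norm (h d - h c)) < e)"

text \<open>Bridge between the gauge integral, whose sums run over tagged intervals, and absolute
  continuity, which speaks of finite sets of endpoint pairs. Dropping the tags needs a summand that
  vanishes on degenerate boxes, hence \<open>F c c = 0\<close>.\<close>

lemma tagged_partial_division_sum_Icc:
  fixes F :: "real \<Rightarrow> real \<Rightarrow> 'a::comm_monoid_add"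
  assumes P: "P tagged_partial_division_of {a..b}" and F: "\<And>c. F c c = 0"
  defines "J \<equiv> (\<lambda>K. (Inf K, Sup K)) ` snd ` P"
  shows "(\<Sum>(x,K)\<in>P. F (Inf K) (Sup K)) = (\<Sum>(c,d)\<in>J. F c d)"
    and "finite J" and "\<forall>(c,d)\<in>J. a \<le> c \<and> c \<le> d \<and> d \<le> b"
    and "pairwise (\<lambda>(c,d) (c',d'). {c<..<d} \<inter> {c'<..<d'} = {}) J"
proof -
  have td: "P tagged_division_of \<Union>(snd ` P)"
    by (rule tagged_partial_division_of_Union_self[OF P])
  have div: "snd ` P division_of \<Union>(snd ` P)"
    by (rule division_of_tagged_division[OF td])
  have box: "\<exists>c d. K = {c..d} \<and> c \<le> d \<and> a \<le> c \<and> d \<le> b" if "K \<in> snd ` P" for K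
  proof -
    from that obtain x where x: "(x, K) \<in> P" by auto
    obtain c d where "K = cbox c d" using tagged_partial_division_ofD(4)[OF P x] by blast
    moreover have "x \<in> K" "K \<subseteq> {a..b}" using tagged_partial_division_ofD(2,3)[OF P x] by auto
    ultimately show ?thesis by (auto intro!: exI[of _ c] exI[of _ d])
  qed
  have K: "K = {Inf K..Sup K} \<and> Inf K \<le> Sup K \<and> a \<le> Inf K \<and> Sup K \<le> b" if "K \<in> snd ` P" for K
    using box[OF that] by auto
  \<comment> \<open>A degenerate box may also be empty, where \<open>Inf\<close> and
    \<open>Sup\<close> say nothing; \<open>F'\<close> sets the value 0 there.\<close>
  define F' where "F' K = (if K = {} then 0 else F (Inf K) (Sup K))" for K
  have "(\<Sum>(x,K)\<in>P. F (Inf K) (Sup K)) = (\<Sum>(x,K)\<in>P. F' K)"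
    using tagged_partial_division_ofD(2)[OF P] by (intro sum.cong) (fastforce simp: F'_def)+
  also have "\<dots> = (\<Sum>K\<in>snd ` P. F' K)"
  proof (rule sum.over_tagged_division_lemma[OF td])
    fix u v :: real assume "box u v = {}"
    then show "F' (cbox u v) = 0" by (auto simp: F'_def F)
  qed
  also have "\<dots> = (\<Sum>K\<in>snd ` P. F (Inf K) (Sup K))"
    using division_ofD(3)[OF div] by (intro sum.cong) (auto simp: F'_def)
  also have "\<dots> = (\<Sum>(c,d)\<in>J. F c d)"
  proof -
    have "inj_on (\<lambda>K. (Inf K, Sup K)) (snd ` P)"
      by (rule inj_onI) (metis K prod.inject)
    then show ?thesis unfolding J_def by (subst sum.reindex) simp_all
  qed
  finally show "(\<Sum>(x,K)\<in>P. F (Inf K) (Sup K)) = (\<Sum>(c,d)\<in>J. F c d)" .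
  show "finite J" using tagged_partial_division_ofD(1)[OF P] by (simp add: J_def)
  show "\<forall>(c,d)\<in>J. a \<le> c \<and> c \<le> d \<and> d \<le> b" using K by (auto simp: J_def)
  show "pairwise (\<lambda>(c,d) (c',d'). {c<..<d} \<inter> {c'<..<d'} = {}) J"
  proof (rule pairwiseI)
    fix q q' assume "q \<in> J" "q' \<in> J" "q \<noteq> q'"
    then obtain L M where L: "L \<in> snd ` P" "q = (Inf L, Sup L)" and M: "M \<in> snd ` P" "q' = (Inf M, Sup M)"
      unfolding J_def by (elim imageE[where f="\<lambda>K. (Inf K, Sup K)"]) blast
    with \<open>q \<noteq> q'\<close> have LM: "L \<in> snd ` P" "M \<in> snd ` P" "L \<noteq> M" by auto
    have int: "interior K = {Inf K<..<Sup K}" if "K \<in> snd ` P" for K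
    proof -
      have "interior K = interior {Inf K..Sup K}"
        by (rule arg_cong[OF conjunct1[OF K[OF that]]])
      then show ?thesis by simp
    qed
    show "(case q of (c,d) \<Rightarrow> \<lambda>(c',d'). {c<..<d} \<inter> {c'<..<d'} = {}) q'"
      using division_ofD(5)[OF div LM(1,2,3)]
      by (simp only: L(2) M(2) split_conv int[OF LM(1)] int[OF LM(2)])
  qed
qed

text \<open>Split a Riemann sum by whether the tag lies in \<open>N\<close>. Off \<open>N\<close>
  the derivative controls each term; for tags in \<open>N\<close> only the increments of
  \<open>h\<close> over short intervals remain, and absolute continuity makes their sum
  small.\<close>

lemma has_integral_absolutely_continuous:
  fixes h g :: "real \<Rightarrow> 'a::euclidean_space"
  assumes "a \<le> b" and ac: "absolutely_continuous_Icc a b h" and N: "negligible N"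
    and der: "\<And>t. t \<in> {a..b} - N \<Longrightarrow> (h has_vector_derivative g t) (at t within {a..b})"
  shows "(g has_integral h b - h a) {a..b}"
proof -
  \<comment> \<open>Changing the integrand on \<open>N\<close> does not affect the integral, and
    with value 0 there the tags in \<open>N\<close> add nothing to the Riemann sum.\<close>
  define g' where "g' t = (if t \<in> N then 0 else g t)" for t
  have "(g' has_integral h b - h a) (cbox a b)"
    unfolding has_integral
  proof (intro allI impI)
    fix e :: real assume e: "e > 0"
    obtain \<delta> where \<delta>: "\<delta> > 0" and ac': "\<And>J. finite J \<Longrightarrow> (\<forall>(c,d)\<in>J. a \<le> c \<and> c \<le> d \<and> d \<le> b) \<Longrightarrow>
        pairwise (\<lambda>(c,d) (c',d'). {c<..<d} \<inter> {c'<..<d'} = {}) J \<Longrightarrow>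
        (\<Sum>(c,d)\<in>J. d - c) < \<delta> \<Longrightarrow> (\<Sum>(c,d)\<in>J. norm (h d - h c)) < e / 2"
      using ac[unfolded absolutely_continuous_Icc_def, rule_format, of "e/2"] e by force
    obtain G where G: "open G" "N \<subseteq> G" "G \<in> lmeasurable" "measure lebesgue G < \<delta>"
    proof -
      have Ns: "N \<in> sets lebesgue" using N by (simp add: negligible_iff_null_sets null_setsD2)
      obtain G where G: "open G" "N \<subseteq> G" "G - N \<in> lmeasurable" "emeasure lebesgue (G - N) < ennreal \<delta>"
        using sets_lebesgue_outer_open[OF Ns \<delta>] by metis
      have eq: "G = (G - N) \<union> N" using G(2) by auto
      have "measure lebesgue (G - N) < \<delta>"
        using G(3,4) \<delta> by (simp add: emeasure_eq_measure2 ennreal_less_iff)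
      moreover have "G \<in> lmeasurable"
        using fmeasurable.Un[OF G(3) negligible_imp_measurable[OF N]] eq by simp
      moreover have "measure lebesgue G = measure lebesgue (G - N)"
        using measure_Un_null_set[of "G - N" lebesgue N] G(3) N eq
        by (metis fmeasurableD negligible_iff_null_sets)
      ultimately show ?thesis using that[of G] G by simp
    qed
    \<comment> \<open>The errors at tags off \<open>N\<close> add up to at most
      \<open>e' * (b - a)\<close>, which is at most \<open>e / 2\<close>; the \<open>+ 1\<close>
      covers \<open>a = b\<close>.\<close>
    define e' where "e' = e / (2 * (b - a + 1))"
    have e': "e' > 0" using e \<open>a \<le> b\<close> by (simp add: e'_def)
    have "\<exists>d>0. t \<in> {a..b} - N \<longrightarrow> (\<forall>s\<in>{a..b}. norm (s - t) < d \<longrightarrow>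
        norm (h s - h t - (s - t) *\<^sub>R g t) \<le> e' * norm (s - t))" for t
    proof (cases "t \<in> {a..b} - N")
      case True
      from der[OF True] e' show ?thesis
        unfolding has_vector_derivative_def has_derivative_within_alt by auto
    qed (auto intro: exI[of _ 1])
    then obtain d where d: "\<And>t. d t > 0" "\<And>t s. t \<in> {a..b} - N \<Longrightarrow> s \<in> {a..b} \<Longrightarrow> norm (s - t) < d t \<Longrightarrow>
        norm (h s - h t - (s - t) *\<^sub>R g t) \<le> e' * norm (s - t)" by metis
    \<comment> \<open>Tags in \<open>N\<close> only see intervals inside \<open>G\<close>, whose total length is below \<open>\<delta>\<close>.\<close>
    define \<Gamma> where "\<Gamma> t = (if t \<in> N then G else ball t (d t))" for t
    have gauge: "gauge \<Gamma>" unfolding gauge_def \<Gamma>_def using d(1) G by auto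
    have bound: "norm ((\<Sum>(x,k)\<in>p. measure lborel k *\<^sub>R g' x) - (h b - h a)) < e"
      if p: "p tagged_division_of cbox a b" and fine: "\<Gamma> fine p" for p
    proof -
      have pI: "p tagged_division_of {a..b}" using p by simp
      note pD = tagged_division_ofD[OF pI]
      define P where "P = {q \<in> p. fst q \<in> N}"
      define Q where "Q = {q \<in> p. fst q \<notin> N}"
      have fin: "finite p" by (rule pD(1))
      have PQ: "p = P \<union> Q" "P \<inter> Q = {}" "finite P" "finite Q" using fin by (auto simp: P_def Q_def)
      have Pp: "P tagged_partial_division_of {a..b}"
        by (rule tagged_partial_division_subset[of p]) (use pI in \<open>auto simp: tagged_division_of_def P_def\<close>)
      define J where "J = (\<lambda>K. (Inf K, Sup K)) ` snd ` P"
      note J = tagged_partial_division_sum_Icc[OF Pp, folded J_def]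
      have boxK: "K = {Inf K..Sup K} \<and> Inf K \<le> x \<and> x \<le> Sup K \<and> a \<le> Inf K \<and> Sup K \<le> b"
        if "(x, K) \<in> p" for x K
      proof -
        obtain u v where "K = cbox u v" using pD(4) \<open>(x, K) \<in> p\<close> by blast
        then show ?thesis using pD(2,3)[OF \<open>(x, K) \<in> p\<close>] by auto
      qed
      have div: "snd ` P division_of \<Union>(snd ` P)"
        by (rule division_of_tagged_division[OF tagged_partial_division_of_Union_self[OF Pp]])
      have "(\<Sum>(c,d)\<in>J. d - c) = (\<Sum>(x,K)\<in>P. Sup K - Inf K)"
        by (rule J(1)[symmetric]) simp
      also have "\<dots> = (\<Sum>(x,K)\<in>P. measure lborel K)"
      proof (rule sum.cong[OF refl], clarify)
        fix x K assume "(x, K) \<in> P"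
        then have xK: "(x, K) \<in> p" by (simp add: P_def)
        have "measure lborel K = measure lborel {Inf K..Sup K}"
          by (rule arg_cong[OF conjunct1[OF boxK[OF xK]]])
        moreover have "Inf K \<le> Sup K" using boxK[OF xK] order_trans by blast
        ultimately show "Sup K - Inf K = measure lborel K" by simp
      qed
      also have "\<dots> = (\<Sum>K\<in>snd ` P. measure lborel K)"
        by (rule sum.over_tagged_division_lemma[OF tagged_partial_division_of_Union_self[OF Pp]])
           (simp add: content_eq_0_interior)
      also have "\<dots> = (\<Sum>K\<in>snd ` P. measure lebesgue K)"
        using div by (intro sum.cong refl) (auto dest!: division_ofD(4) simp: measure_lborel_cbox_eq)
      also have "\<dots> = measure lebesgue (\<Union>(snd ` P))"
        by (rule content_division[OF div])
      also have "\<dots> \<le> measure lebesgue G"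
      proof (rule measure_mono_fmeasurable)
        show "\<Union>(snd ` P) \<subseteq> G" using fine by (force simp: P_def fine_def \<Gamma>_def)
        show "\<Union>(snd ` P) \<in> sets lebesgue"
          using div lmeasurable_division fmeasurableD by blast
      qed (rule G(3))
      finally have Jsmall: "(\<Sum>(c,d)\<in>J. d - c) < \<delta>" using G(4) by simp
      have "norm (\<Sum>(x,K)\<in>P. h (Sup K) - h (Inf K)) \<le> (\<Sum>(x,K)\<in>P. norm (h (Sup K) - h (Inf K)))"
        by (rule sum_norm_le) auto
      also have "\<dots> = (\<Sum>(c,d)\<in>J. norm (h d - h c))"
        by (rule J(1)) simp
      also have "\<dots> < e / 2" 
        by (rule ac'[OF J(2,3,4) Jsmall]) auto
      finally have P_small: "norm (\<Sum>(x,K)\<in>P. h (Sup K) - h (Inf K)) < e / 2" .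
      \<comment> \<open>Straddle estimate: the tag lies between the endpoints, so its distances to
        them add up to exactly the length of \<open>K\<close>, and the error is proportional to that
        length.\<close>
      have Q1: "norm (measure lborel K *\<^sub>R g x - (h (Sup K) - h (Inf K))) \<le> e' * measure lborel K" if xK: "(x, K) \<in> Q" for x K
      proof -
        have xp: "(x, K) \<in> p" and xN: "x \<notin> N" using xK by (auto simp: Q_def)
        define c where "c = Inf K"
        define dd where "dd = Sup K"
        have K: "K = {c..dd}" "c \<le> x" "x \<le> dd" "a \<le> c" "dd \<le> b"
          using boxK[OF xp] by (auto simp: c_def dd_def)
        have KB: "K \<subseteq> ball x (d x)" using fineD[OF fine xp] xN by (simp add: \<Gamma>_def)
        have "c \<in> K" "dd \<in> K" using K by auto
        then have "norm (c - x) < d x" "norm (dd - x) < d x"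
          using KB by (auto simp: dist_norm norm_minus_commute subset_iff)
        then have 1: "norm (h c - h x - (c - x) *\<^sub>R g x) \<le> e' * norm (c - x)"
          and 2: "norm (h dd - h x - (dd - x) *\<^sub>R g x) \<le> e' * norm (dd - x)"
          using d(2)[of x c] d(2)[of x dd] K xN by auto
        have "measure lborel K *\<^sub>R g x - (h dd - h c)
            = (h c - h x - (c - x) *\<^sub>R g x) - (h dd - h x - (dd - x) *\<^sub>R g x)"
          using K by (simp add: algebra_simps)
        also have "norm \<dots> \<le> e' * norm (c - x) + e' * norm (dd - x)"
          using norm_triangle_ineq4 1 2 by (meson add_mono order_trans)
        also have "\<dots> = e' * measure lborel K" using K by (simp add: algebra_simps)
        finally show ?thesis by (simp add: c_def dd_def)
      qed
      have "norm (\<Sum>(x,K)\<in>Q. measure lborel K *\<^sub>R g x - (h (Sup K) - h (Inf K))) \<le> (\<Sum>(x,K)\<in>Q. e' * measure lborel K)"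
        by (rule sum_norm_le) (use Q1 in auto)
      also have "\<dots> \<le> (\<Sum>(x,K)\<in>p. e' * measure lborel K)"
        by (rule sum_mono2) (use PQ fin e' in auto)
      also have "\<dots> = e' * (b - a)"
        using additive_content_tagged_division[OF p] \<open>a \<le> b\<close>
        by (simp add: sum_distrib_left[symmetric] split_def)
      also have "\<dots> \<le> e / 2"
        using e \<open>a \<le> b\<close> by (simp add: e'_def field_simps)
      finally have Q_small: "norm (\<Sum>(x,K)\<in>Q. measure lborel K *\<^sub>R g x - (h (Sup K) - h (Inf K))) \<le> e / 2" .
      have "h b - h a = (\<Sum>(x,K)\<in>p. h (Sup K) - h (Inf K))"
        using additive_tagged_division_1[OF \<open>a \<le> b\<close> pI, of h] by simp
      also have "\<dots> = (\<Sum>(x,K)\<in>P. h (Sup K) - h (Inf K)) + (\<Sum>(x,K)\<in>Q. h (Sup K) - h (Inf K))"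
        using PQ by (simp add: sum.union_disjoint)
      finally have hb: "h b - h a = \<dots>" .
      have "(\<Sum>(x,K)\<in>p. measure lborel K *\<^sub>R g' x) = (\<Sum>(x,K)\<in>P. measure lborel K *\<^sub>R g' x) + (\<Sum>(x,K)\<in>Q. measure lborel K *\<^sub>R g' x)"
        using PQ by (simp add: sum.union_disjoint)
      also have "(\<Sum>(x,K)\<in>P. measure lborel K *\<^sub>R g' x) = 0"
        by (rule sum.neutral) (auto simp: P_def g'_def)
      also have "(\<Sum>(x,K)\<in>Q. measure lborel K *\<^sub>R g' x) = (\<Sum>(x,K)\<in>Q. measure lborel K *\<^sub>R g x)"
        by (rule sum.cong) (auto simp: Q_def g'_def)
      finally have "(\<Sum>(x,K)\<in>p. measure lborel K *\<^sub>R g' x) - (h b - h a)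
          = (\<Sum>(x,K)\<in>Q. measure lborel K *\<^sub>R g x - (h (Sup K) - h (Inf K))) - (\<Sum>(x,K)\<in>P. h (Sup K) - h (Inf K))"
        by (simp add: hb split_def sum_subtractf)
      also have "norm \<dots> < e"
        using norm_triangle_ineq4[of "\<Sum>(x,K)\<in>Q. measure lborel K *\<^sub>R g x - (h (Sup K) - h (Inf K))"
            "\<Sum>(x,K)\<in>P. h (Sup K) - h (Inf K)"] P_small Q_small by linarith
      finally show ?thesis .
    qed
    show "\<exists>\<gamma>. gauge \<gamma> \<and> (\<forall>\<D>. \<D> tagged_division_of cbox a b \<and> \<gamma> fine \<D> \<longrightarrow>
        norm ((\<Sum>(x, k)\<in>\<D>. measure lborel k *\<^sub>R g' x) - (h b - h a)) < e)" by (intro exI[of _ \<Gamma>] conjI allI impI gauge bound) simp_all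
  qed
  then have "(g' has_integral h b - h a) {a..b}" by simp
  then show ?thesis
    by (rule has_integral_spike[OF N, rotated]) (simp add: g'_def)
qed

section \<open>Test functions along a trajectory\<close>

text \<open>An increment of the graph is at most the length of the interval plus the increment of
  \<open>\<omega>\<close>; both sums are small, and the Lipschitz bound passes this on to
  \<open>F\<close>.\<close>

lemma absolutely_continuous_Icc_Lipschitz_Pair:
  fixes \<omega> :: "real \<Rightarrow> 'a::real_normed_vector" and F :: "real \<times> 'a \<Rightarrow> 'b::real_normed_vector"
  assumes \<omega>: "absolutely_continuous_Icc a b \<omega>"
    and S: "\<And>t. t \<in> {a..b} \<Longrightarrow> (t, \<omega> t) \<in> S"
    and F: "\<And>x y. x \<in> S \<Longrightarrow> y \<in> S \<Longrightarrow> norm (F x - F y) \<le> L * norm (x - y)"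
  shows "absolutely_continuous_Icc a b (\<lambda>t. F (t, \<omega> t))"
  unfolding absolutely_continuous_Icc_def
proof (intro allI impI)
  fix e :: real assume e: "e > 0"
  \<comment> \<open>Lengths and increments of \<open>\<omega>\<close> each get a budget of
    \<open>e'\<close>; this is why the lengths are kept below \<open>min \<delta> e'\<close>. Using
    \<open>\<bar>L\<bar> + 1\<close> makes the factor positive whatever \<open>L\<close> is.\<close>
  define e' where "e' = e / (2 * (\<bar>L\<bar> + 1))"
  have e': "e' > 0" using e by (simp add: e'_def add_nonneg_pos)
  obtain \<delta> where \<delta>: "\<delta> > 0" and ac: "\<And>J. finite J \<Longrightarrow> (\<forall>(c,d)\<in>J. a \<le> c \<and> c \<le> d \<and> d \<le> b) \<Longrightarrow>
        pairwise (\<lambda>(c,d) (c',d'). {c<..<d} \<inter> {c'<..<d'} = {}) J \<Longrightarrow>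
        (\<Sum>(c,d)\<in>J. d - c) < \<delta> \<Longrightarrow> (\<Sum>(c,d)\<in>J. norm (\<omega> d - \<omega> c)) < e'"
    using \<omega>[unfolded absolutely_continuous_Icc_def, rule_format, of e'] e' by force
  have "(\<Sum>(c,d)\<in>J. norm (F (d, \<omega> d) - F (c, \<omega> c))) < e"
    if J: "finite J" "\<forall>(c,d)\<in>J. a \<le> c \<and> c \<le> d \<and> d \<le> b"
      "pairwise (\<lambda>(c,d) (c',d'). {c<..<d} \<inter> {c'<..<d'} = {}) J"
      "(\<Sum>(c,d)\<in>J. d - c) < min \<delta> e'" for J
  proof -
    have "norm (F (d, \<omega> d) - F (c, \<omega> c)) \<le> (\<bar>L\<bar> + 1) * ((d - c) + norm (\<omega> d - \<omega> c))"
      if "(c, d) \<in> J" for c d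
    proof -
      have cd: "a \<le> c" "c \<le> d" "d \<le> b" using J(2) that by auto
      have "norm (F (d, \<omega> d) - F (c, \<omega> c)) \<le> L * norm ((d, \<omega> d) - (c, \<omega> c))"
        using cd by (intro F S) auto
      also have "\<dots> \<le> (\<bar>L\<bar> + 1) * norm ((d, \<omega> d) - (c, \<omega> c))"
        by (intro mult_right_mono) auto
      also have "norm ((d, \<omega> d) - (c, \<omega> c)) \<le> (d - c) + norm (\<omega> d - \<omega> c)"
        using norm_Pair_le[of "d - c" "\<omega> d - \<omega> c"] cd by simp
      finally show ?thesis by (simp add: mult_left_mono)
    qed
    then have "(\<Sum>(c,d)\<in>J. norm (F (d, \<omega> d) - F (c, \<omega> c)))
        \<le> (\<Sum>(c,d)\<in>J. (\<bar>L\<bar> + 1) * ((d - c) + norm (\<omega> d - \<omega> c)))"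
      by (intro sum_mono) auto
    also have "\<dots> = (\<bar>L\<bar> + 1) * ((\<Sum>(c,d)\<in>J. d - c) + (\<Sum>(c,d)\<in>J. norm (\<omega> d - \<omega> c)))"
      by (simp add: sum_distrib_left sum.distrib[symmetric] split_def)
    also have "\<dots> < (\<bar>L\<bar> + 1) * (e' + e')"
      using ac[OF J(1-3)] J(4) by (intro mult_strict_left_mono add_strict_mono) auto
    also have "\<dots> = e"
    proof -
      have "M * (e / (2 * M) + e / (2 * M)) = e" if "M > 0" for M :: real
        using that by (simp add: field_simps)
      from this[of "\<bar>L\<bar> + 1"] show ?thesis by (simp add: e'_def add_nonneg_pos)
    qed
    finally show ?thesis .
  qed
  then show "\<exists>\<delta>>0. \<forall>J. finite J \<longrightarrow> (\<forall>(c,d)\<in>J. a \<le> c \<and> c \<le> d \<and> d \<le> b) \<longrightarrow>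
        pairwise (\<lambda>(c,d) (c',d'). {c<..<d} \<inter> {c'<..<d'} = {}) J \<longrightarrow>
        (\<Sum>(c,d)\<in>J. d - c) < \<delta> \<longrightarrow> (\<Sum>(c,d)\<in>J. norm (F (d, \<omega> d) - F (c, \<omega> c))) < e"
    using \<delta> e' by (intro exI[of _ "min \<delta> e'"]) simp
qed

lemma C1c_has_derivative:
  assumes "\<phi> \<in> C1c T" "q \<in> {0..T} \<times> UNIV"
  shows "(\<phi> has_derivative dtest T \<phi> q) (at q within {0..T} \<times> UNIV)"
  using assms unfolding C1c_def differentiable_on_def dtest_def frechet_derivative_works by blast

lemma C1c_linear_dtest:
  assumes "\<phi> \<in> C1c T" "q \<in> {0..T} \<times> UNIV"
  shows "linear (dtest T \<phi> q)"
  using C1c_has_derivative[OF assms] by (rule has_derivative_linear)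

text \<open>\<open>C1c\<close> gives continuity of the derivative one direction at a time, not in
  operator norm. Bounds in the finitely many basis directions suffice: by linearity their sum bounds
  the operator norm, and convexity allows the mean value inequality.\<close>

lemma C1c_Lipschitz_on_compact:
  fixes \<phi> :: "real \<times> (real^'d) \<Rightarrow> real"
  assumes \<phi>: "\<phi> \<in> C1c T" and K: "compact K" "convex K" "K \<subseteq> {0..T} \<times> UNIV"
  obtains L where "\<And>x y. x \<in> K \<Longrightarrow> y \<in> K \<Longrightarrow> norm (\<phi> x - \<phi> y) \<le> L * norm (x - y)"
proof -
  have "\<exists>B. \<forall>q\<in>K. norm (dtest T \<phi> q b) \<le> B" for b
  proof -
    have "continuous_on K (\<lambda>q. dtest T \<phi> q b)"
      using \<phi> K(3) continuous_on_subset unfolding C1c_def by blast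
    then have "bounded ((\<lambda>q. dtest T \<phi> q b) ` K)"
      using K(1) compact_continuous_image compact_imp_bounded by blast
    then show ?thesis unfolding bounded_iff by auto
  qed
  then obtain B where B: "\<And>b q. q \<in> K \<Longrightarrow> norm (dtest T \<phi> q b) \<le> B b" by metis
  define L where "L = (\<Sum>b\<in>Basis. B b)"
  have "onorm (dtest T \<phi> q) \<le> L" if q: "q \<in> K" for q
  proof (rule onorm_le)
    fix v
    have lin: "linear (dtest T \<phi> q)" using C1c_linear_dtest \<phi> K(3) q by blast
    have "dtest T \<phi> q v = dtest T \<phi> q (\<Sum>b\<in>Basis. (v \<bullet> b) *\<^sub>R b)" by (simp only: euclidean_representation)
    also have "\<dots> = (\<Sum>b\<in>Basis. (v \<bullet> b) *\<^sub>R dtest T \<phi> q b)"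
      by (simp add: linear_sum[OF lin] linear_cmul[OF lin] del: euclidean_representation)
    also have "norm \<dots> \<le> (\<Sum>b\<in>Basis. B b * norm v)"
    proof (rule sum_norm_le)
      fix b :: "real \<times> (real^'d)" assume "b \<in> Basis"
      then have "\<bar>v \<bullet> b\<bar> * norm (dtest T \<phi> q b) \<le> norm v * B b"
        by (intro mult_mono Basis_le_norm B q) auto
      then show "norm ((v \<bullet> b) *\<^sub>R dtest T \<phi> q b) \<le> B b * norm v"
        by (simp add: mult.commute abs_mult)
    qed
    finally show "norm (dtest T \<phi> q v) \<le> L * norm v" by (simp add: L_def sum_distrib_right)
  qed
  moreover have "(\<phi> has_derivative dtest T \<phi> q) (at q within K)" if "q \<in> K" for q
    using has_derivative_subset[OF C1c_has_derivative[OF \<phi>] K(3)] K(3) that by blast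
  ultimately have "norm (\<phi> x - \<phi> y) \<le> L * norm (x - y)" if "x \<in> K" "y \<in> K" for x y
    using differentiable_bound[OF K(2), of \<phi> "dtest T \<phi>" L x y] that by blast
  then show thesis by (rule that)
qed

text \<open>The fundamental theorem yields a gauge integral; integrability is assumed so that the
  Lebesgue integral is that same gauge integral.\<close>

lemma integral_transport_integrand_along:
  fixes \<phi> :: "real \<times> (real^'d) \<Rightarrow> real" and \<omega> :: "real \<Rightarrow> real^'d"
  assumes "T > 0" and \<phi>: "\<phi> \<in> C1c T" and tr: "(\<omega>, u) \<in> trajectories T p U f"
    and int: "integrable (lebesgue_on {0..T}) (\<lambda>t. transport_integrand T f \<phi> (t, \<omega> t, u t))"
  shows "(\<integral>t. transport_integrand T f \<phi> (t, \<omega> t, u t) \<partial>lebesgue_on {0..T}) = \<phi> (T, \<omega> T) - \<phi> (0, \<omega> 0)"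
proof -
  define X :: "(real \<times> (real^'d)) set" where "X = {0..T} \<times> UNIV"
  have cont: "continuous_on {0..T} \<omega>" and ac: "absolutely_continuous_Icc 0 T \<omega>"
    and ae: "AE t in lebesgue_on {0..T}. (\<omega> has_vector_derivative f (\<omega> t) (u t)) (at t within {0..T})"
    using tr by (auto simp: trajectories_def absolutely_continuous_path_def absolutely_continuous_Icc_def)
  obtain N where N: "N \<in> null_sets (lebesgue_on {0..T})"
    and der: "\<And>t. t \<in> {0..T} - N \<Longrightarrow> (\<omega> has_vector_derivative f (\<omega> t) (u t)) (at t within {0..T})"
    using AE_E3[OF ae] by auto
  have negN: "negligible N"
    using N by (simp add: negligible_iff_null_sets null_sets_restrict_space)
  have "bounded (\<omega> ` {0..T})"
    using cont compact_continuous_image compact_imp_bounded compact_Icc by blast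
  \<comment> \<open>The image of the path need not be convex; a ball around it gives the compact
    convex set on which \<open>\<phi>\<close> is Lipschitz.\<close>
  then obtain R where R: "\<And>t. t \<in> {0..T} \<Longrightarrow> norm (\<omega> t) \<le> R" unfolding bounded_iff by blast
  obtain L where L: "\<And>x y. x \<in> {0..T} \<times> cball 0 R \<Longrightarrow> y \<in> {0..T} \<times> cball 0 R \<Longrightarrow>
      norm (\<phi> x - \<phi> y) \<le> L * norm (x - y)"
    using C1c_Lipschitz_on_compact[OF \<phi>, of "{0..T} \<times> cball 0 R"]
    by (auto simp: compact_Times convex_Times)
  have ach: "absolutely_continuous_Icc 0 T (\<lambda>t. \<phi> (t, \<omega> t))"
    by (rule absolutely_continuous_Icc_Lipschitz_Pair[OF ac _ L]) (use R in auto)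
  have "((\<lambda>t. \<phi> (t, \<omega> t)) has_vector_derivative transport_integrand T f \<phi> (t, \<omega> t, u t)) (at t within {0..T})"
    if t: "t \<in> {0..T} - N" for t
  proof -
    let ?q = "(t, \<omega> t)" and ?w = "f (\<omega> t) (u t)"
    have q: "?q \<in> {0..T} \<times> UNIV" using t by auto
    have lin: "linear (dtest T \<phi> ?q)" by (rule C1c_linear_dtest[OF \<phi> q])
    have "((\<lambda>t. (t, \<omega> t)) has_derivative (\<lambda>s. (s, s *\<^sub>R ?w))) (at t within {0..T})"
      using der[OF t] unfolding has_vector_derivative_def by (intro has_derivative_Pair has_derivative_ident)
    \<comment> \<open>The graph stays in the strip, so the derivative of \<open>\<phi>\<close>
      relative to the strip is enough for the chain rule, also at the end times.\<close>
    moreover have "(\<phi> has_derivative dtest T \<phi> ?q) (at ?q within (\<lambda>t. (t, \<omega> t)) ` {0..T})"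
      by (rule has_derivative_subset[OF C1c_has_derivative[OF \<phi> q]]) auto
    ultimately have "((\<lambda>t. \<phi> (t, \<omega> t)) has_derivative (\<lambda>s. dtest T \<phi> ?q (s, s *\<^sub>R ?w))) (at t within {0..T})"
      by (rule has_derivative_in_compose)
    moreover have "dtest T \<phi> ?q (s, s *\<^sub>R ?w) = s *\<^sub>R transport_integrand T f \<phi> (t, \<omega> t, u t)" for s
    proof -
      have "(s, s *\<^sub>R ?w) = s *\<^sub>R ((1, 0) + (0, ?w))" by simp
      then show ?thesis
        by (simp only: linear_cmul[OF lin] linear_add[OF lin] transport_integrand_def split_conv)
    qed
    ultimately show ?thesis unfolding has_vector_derivative_def by simp
  qed
  from has_integral_absolutely_continuous[OF _ ach negN this]
  have "((\<lambda>t. transport_integrand T f \<phi> (t, \<omega> t, u t)) has_integral \<phi> (T, \<omega> T) - \<phi> (0, \<omega> 0)) {0..T}"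
    using \<open>T > 0\<close> by simp
  moreover have "((\<lambda>t. transport_integrand T f \<phi> (t, \<omega> t, u t)) has_integral
      (\<integral>t. transport_integrand T f \<phi> (t, \<omega> t, u t) \<partial>lebesgue_on {0..T})) {0..T}"
    by (rule has_integral_integral_lebesgue_on[OF int]) simp
  ultimately show ?thesis by (rule has_integral_unique[rotated])
qed

section \<open>The Borel structure on trajectories\<close>

text \<open>Takes the place of Hoelder's inequality on a bounded interval. Above the threshold
  \<open>c\<close> write \<open>a = a powr (1 - p) * a powr p\<close> and use that the exponent
  \<open>1 - p\<close> is not positive.\<close>

lemma le_add_powr:
  fixes a c p :: real
  assumes "a \<ge> 0" "c > 0" "p \<ge> 1"
  shows "a \<le> c + c powr (1 - p) * a powr p"
proof (cases "a \<le> c")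
  case False
  then have "a = a powr (1 - p) * a powr p"
    using assms by (simp add: powr_add[symmetric])
  also have "\<dots> \<le> c powr (1 - p) * a powr p"
    using assms False by (intro mult_right_mono powr_mono2') auto
  finally show ?thesis using assms by simp
qed (use assms in \<open>simp add: add_increasing2\<close>)

lemma norm_diff_powr_le:
  fixes x y :: "'a::real_normed_vector"
  assumes "p \<ge> 0"
  shows "norm (x - y) powr p \<le> 2 powr p * (norm x powr p + norm y powr p)"
proof -
  have "norm (x - y) powr p \<le> (2 * max (norm x) (norm y)) powr p"
    using norm_triangle_ineq4[of x y] assms by (intro powr_mono2) auto
  also have "\<dots> = 2 powr p * max (norm x) (norm y) powr p"
    by (intro powr_mult)
  also have "\<dots> \<le> 2 powr p * (norm x powr p + norm y powr p)"
    by (intro mult_left_mono) (auto simp: max_def)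
  finally show ?thesis .
qed

lemma trajectories_borel_space: "space (trajectories_borel T p U f) = trajectories T p U f"
  and trajectories_borel_open: "trajectories_open T p U f V \<Longrightarrow> V \<in> sets (trajectories_borel T p U f)"
proof -
  have *: "{V. trajectories_open T p U f V} \<subseteq> Pow (trajectories T p U f)"
    by (auto simp: trajectories_open_def)
  show "space (trajectories_borel T p U f) = trajectories T p U f"
    unfolding trajectories_borel_def by (rule space_measure_of[OF *])
  show "trajectories_open T p U f V \<Longrightarrow> V \<in> sets (trajectories_borel T p U f)"
    unfolding trajectories_borel_def by (simp add: sets_measure_of[OF *] sigma_sets.Basic)
qed

section \<open>Measurability of functionals of a trajectory\<close>

lemma finite_measure_lebesgue_on_Icc: "finite_measure (lebesgue_on {a..b::real})"
  by (rule finite_measure_lebesgue_on) simp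

lemma trajectories_graph_measurable:
  fixes u :: "real \<Rightarrow> real^'n" and \<omega> :: "real \<Rightarrow> real^'d"
  assumes "(\<omega>, u) \<in> trajectories T p U f"
  shows "(\<lambda>t. (t, \<omega> t, u t)) \<in> borel_measurable (lebesgue_on {0..T})"
proof -
  have 1: "\<omega> \<in> borel_measurable (lebesgue_on {0..T})"
    using assms by (auto simp: trajectories_def intro!: continuous_imp_measurable_on_sets_lebesgue)
  have 2: "u \<in> borel_measurable (lebesgue_on {0..T})"
    using assms by (auto simp: trajectories_def controls_def)
  have 3: "(\<lambda>t. t) \<in> borel_measurable (lebesgue_on {0..T})"
    by (intro continuous_imp_measurable_on_sets_lebesgue continuous_on_id) simp
  show ?thesis by (intro borel_measurable_Pair 1 2 3)
qed

text \<open>Use \<open>le_add_powr\<close> with threshold \<open>c = e\<close>. The constant term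
  integrates to \<open>e * T\<close>; the p-th power integrates to at most \<open>e powr p\<close>,
  which the factor \<open>e powr (1 - p)\<close> turns into \<open>e\<close>.\<close>

lemma integral_norm_diff_le_Lp_dist:
  fixes u v :: "real \<Rightarrow> real^'n"
  assumes "T \<ge> 0" "p \<ge> 1" and u: "u \<in> controls T p U" and v: "v \<in> controls T p U"
    and e: "Lp_dist T p u v < e"
  shows "integrable (lebesgue_on {0..T}) (\<lambda>t. norm (u t - v t))"
    and "(\<integral>t. norm (u t - v t) \<partial>lebesgue_on {0..T}) \<le> (T + 1) * e"
proof -
  let ?M = "lebesgue_on {0..T}"
  interpret finite_measure ?M by (rule finite_measure_lebesgue_on_Icc)
  have e0: "e > 0" using e by (auto simp: Lp_dist_def intro: le_less_trans[OF powr_ge_zero])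
  have [measurable]: "u \<in> borel_measurable ?M" "v \<in> borel_measurable ?M"
    using u v by (auto simp: controls_def)
  have intp: "integrable ?M (\<lambda>t. norm (u t - v t) powr p)"
  proof (rule Bochner_Integration.integrable_bound)
    show "integrable ?M (\<lambda>t. 2 powr p * (norm (u t) powr p + norm (v t) powr p))"
      using u v by (auto simp: controls_def)
    show "AE t in ?M. norm (norm (u t - v t) powr p) \<le> norm (2 powr p * (norm (u t) powr p + norm (v t) powr p))"
      using norm_diff_powr_le[of p] \<open>p \<ge> 1\<close> by auto
  qed measurable
  have bnd: "norm (u t - v t) \<le> e + e powr (1 - p) * norm (u t - v t) powr p" for t
    by (rule le_add_powr) (use e0 \<open>p \<ge> 1\<close> in auto)
  have intb: "integrable ?M (\<lambda>t. e + e powr (1 - p) * norm (u t - v t) powr p)"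
    using intp by simp
  show int: "integrable ?M (\<lambda>t. norm (u t - v t))"
    by (rule Bochner_Integration.integrable_bound[OF intb]) (use bnd e0 in \<open>auto simp: add_nonneg_nonneg\<close>)
  define I where "I = (\<integral>t. norm (u t - v t) powr p \<partial>?M)"
  have "I \<ge> 0" by (simp add: I_def)
  then have "I = (I powr (1 / p)) powr p" using \<open>p \<ge> 1\<close> by (simp add: powr_powr)
  also have "\<dots> \<le> e powr p"
    using e \<open>p \<ge> 1\<close> by (intro powr_mono2) (auto simp: Lp_dist_def I_def)
  finally have I: "I \<le> e powr p" .
  have "(\<integral>t. norm (u t - v t) \<partial>?M) \<le> (\<integral>t. e + e powr (1 - p) * norm (u t - v t) powr p \<partial>?M)"
    by (rule integral_mono[OF int intb bnd])
  also have "\<dots> = e * T + e powr (1 - p) * I"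
    using intp \<open>T \<ge> 0\<close> by (simp add: I_def measure_restrict_space)
  also have "e powr (1 - p) * I \<le> e powr (1 - p) * e powr p"
    by (rule mult_left_mono[OF I]) simp
  also have "\<dots> = e" using e0 by (simp add: powr_add[symmetric])
  finally show "(\<integral>t. norm (u t - v t) \<partial>?M) \<le> (T + 1) * e" by (simp add: algebra_simps)
qed

text \<open>The functional is even Lipschitz for \<open>C \<times> L\<^sup>p\<close>, so preimages of open sets are open.\<close>

lemma integral_along_Lipschitz_measurable:
  fixes g :: "real \<times> (real^'d) \<times> (real^'n) \<Rightarrow> real" and U :: "(real^'n) set"
  assumes "T \<ge> 0" "p \<ge> 1" and g: "L-lipschitz_on UNIV g" and B: "\<And>q. \<bar>g q\<bar> \<le> B"
  shows "(\<lambda>z. \<integral>t. g (t, fst z t, snd z t) \<partial>lebesgue_on {0..T}) \<in> borel_measurable (trajectories_borel T p U f)"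
    (is "?F \<in> _")
proof (rule borel_measurableI)
  fix G :: "real set" assume "open G"
  let ?M = "lebesgue_on {0..T}" and ?\<Omega> = "trajectories T p U f"
  interpret finite_measure ?M by (rule finite_measure_lebesgue_on_Icc)
  have L0: "L \<ge> 0" using g by (rule lipschitz_on_nonneg)
  have gm: "g \<in> borel_measurable borel"
    using lipschitz_on_continuous_on[OF g] by (rule borel_measurable_continuous_onI)
  have meas: "(\<lambda>t. g (t, fst z t, snd z t)) \<in> borel_measurable ?M" if "z \<in> ?\<Omega>" for z
    using measurable_compose[OF trajectories_graph_measurable gm, of "fst z" "snd z"] that by simp
  have int: "integrable ?M (\<lambda>t. g (t, fst z t, snd z t))" if "z \<in> ?\<Omega>" for z
    by (rule integrable_const_bound[of _ B]) (use meas[OF that] B in auto)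
  \<comment> \<open>The time coordinates agree. The states contribute at most \<open>T * e\<close>
    and the controls at most \<open>(T + 1) * e\<close>, whence \<open>2 * T + 1\<close>.\<close>
  have est: "\<bar>?F z' - ?F z\<bar> \<le> L * ((2 * T + 1) * e)"
    if z: "z \<in> ?\<Omega>" "z' \<in> ?\<Omega>" and d: "\<forall>t\<in>{0..T}. dist (fst z' t) (fst z t) < e" "Lp_dist T p (snd z') (snd z) < e"
    for z z' e
  proof -
    have cu: "snd z \<in> controls T p U" "snd z' \<in> controls T p U" using z by (auto simp: trajectories_def)
    note u = integral_norm_diff_le_Lp_dist[OF \<open>T \<ge> 0\<close> \<open>p \<ge> 1\<close> cu(2,1) d(2)]
    have "\<bar>?F z' - ?F z\<bar> = \<bar>\<integral>t. g (t, fst z' t, snd z' t) - g (t, fst z t, snd z t) \<partial>?M\<bar>"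
      using int z by (subst Bochner_Integration.integral_diff) auto
    also have "\<dots> \<le> (\<integral>t. \<bar>g (t, fst z' t, snd z' t) - g (t, fst z t, snd z t)\<bar> \<partial>?M)"
      by (rule integral_abs_bound)
    also have "\<dots> \<le> (\<integral>t. L * (e + norm (snd z' t - snd z t)) \<partial>?M)"
    proof (rule integral_mono)
      show "integrable ?M (\<lambda>t. \<bar>g (t, fst z' t, snd z' t) - g (t, fst z t, snd z t)\<bar>)"
        using int z by auto
      show "integrable ?M (\<lambda>t. L * (e + norm (snd z' t - snd z t)))" using u(1) by simp
      fix t assume "t \<in> space ?M"
      then have t: "dist (fst z' t) (fst z t) < e" using d by auto
      have "\<bar>g (t, fst z' t, snd z' t) - g (t, fst z t, snd z t)\<bar>
          \<le> L * dist (t, fst z' t, snd z' t) (t, fst z t, snd z t)"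
        using lipschitz_onD[OF g, of "(t, fst z' t, snd z' t)" "(t, fst z t, snd z t)"] by (simp add: dist_real_def)
      also have "dist (t, fst z' t, snd z' t) (t, fst z t, snd z t) = dist (fst z' t, snd z' t) (fst z t, snd z t)"
        by (simp add: dist_Pair_Pair)
      also have "\<dots> \<le> norm (fst z' t - fst z t) + norm (snd z' t - snd z t)"
        using norm_Pair_le[of "fst z' t - fst z t" "snd z' t - snd z t"] by (simp add: dist_norm)
      also have "\<dots> \<le> e + norm (snd z' t - snd z t)" using t by (simp add: dist_norm)
      finally show "\<bar>g (t, fst z' t, snd z' t) - g (t, fst z t, snd z t)\<bar> \<le> L * (e + norm (snd z' t - snd z t))"
        using L0 by (simp add: mult_left_mono)
    qed
    also have "\<dots> = L * (e * T + (\<integral>t. norm (snd z' t - snd z t) \<partial>?M))"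
      using u(1) \<open>T \<ge> 0\<close> by (simp add: measure_restrict_space)
    also have "\<dots> \<le> L * ((2 * T + 1) * e)"
      using u(2) L0 by (intro mult_left_mono) (auto simp: algebra_simps)
    finally show ?thesis .
  qed
  have "trajectories_open T p U f (?F -` G \<inter> ?\<Omega>)"
    unfolding trajectories_open_def
  proof (intro conjI ballI)
    fix z assume z: "z \<in> ?F -` G \<inter> ?\<Omega>"
    then obtain r where r: "r > 0" "ball (?F z) r \<subseteq> G" using \<open>open G\<close> openE by blast
    \<comment> \<open>Chosen so that \<open>est\<close> stays strictly below \<open>r\<close>;
      \<open>L + 1\<close> avoids dividing by zero when \<open>L = 0\<close>.\<close>
    define e where "e = r / (2 * ((L + 1) * (2 * T + 1)))"
    have pos: "(L + 1) * (2 * T + 1) > 0" using L0 \<open>T \<ge> 0\<close> by (intro mult_pos_pos) auto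
    then have e: "e > 0" using r by (simp add: e_def)
    have "L * ((2 * T + 1) * e) \<le> (L + 1) * ((2 * T + 1) * e)"
      using e \<open>T \<ge> 0\<close> by (intro mult_right_mono) auto
    also have "\<dots> = ((L + 1) * (2 * T + 1)) * e" by simp
    also have "\<dots> = r / 2" using pos unfolding e_def by (simp add: field_simps)
    also have "\<dots> < r" using r by simp
    finally have er: "L * ((2 * T + 1) * e) < r" .
    have "z' \<in> ?F -` G \<inter> ?\<Omega>"
      if "z' \<in> ?\<Omega>" "\<forall>t\<in>{0..T}. dist (fst z' t) (fst z t) < e" "Lp_dist T p (snd z') (snd z) < e" for z'
    proof -
      have "?F z' \<in> ball (?F z) r"
        using est[of z z' e] z that er by (auto simp: dist_real_def)
      then show ?thesis using r that by blast
    qed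
    then show "case z of (\<omega>, u) \<Rightarrow> \<exists>e>0. \<forall>(\<omega>', u')\<in>?\<Omega>.
        (\<forall>t\<in>{0..T}. dist (\<omega>' t) (\<omega> t) < e) \<and> Lp_dist T p u' u < e \<longrightarrow> (\<omega>', u') \<in> ?F -` G \<inter> ?\<Omega>"
      using e by (cases z) (force intro!: exI[of _ e])
  qed auto
  then show "?F -` G \<inter> space (trajectories_borel T p U f) \<in> sets (trajectories_borel T p U f)"
    unfolding trajectories_borel_space by (rule trajectories_borel_open)
qed

text \<open>The indicator of an open set is the pointwise limit of the bounded Lipschitz functions
  \<open>min 1 (k * infdist q (- A))\<close>; dominated convergence carries this over to the
  integrals along each trajectory.\<close>

lemma emeasure_along_open_measurable:
  fixes A :: "(real \<times> (real^'d) \<times> (real^'n)) set" and U :: "(real^'n) set"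
  assumes "T \<ge> 0" "p \<ge> 1" and A: "open A"
  shows "(\<lambda>z. emeasure (lebesgue_on {0..T}) {t \<in> {0..T}. (t, fst z t, snd z t) \<in> A})
    \<in> borel_measurable (trajectories_borel T p U f)"
\<comment> \<open>The distance to the empty set is 0 by convention, so the approximation would fail
  for \<open>A = UNIV\<close>; there the function is constant.\<close>
proof (cases "A = UNIV")
  case False
  let ?M = "lebesgue_on {0..T}" and ?N = "trajectories_borel T p U f"
  interpret finite_measure ?M by (rule finite_measure_lebesgue_on_Icc)
  define g where "g k q = min 1 (real k * infdist q (- A))" for k q
  have lip: "(real k)-lipschitz_on UNIV (g k)" for k
  proof (rule lipschitz_onI)
    fix x y
    have "\<bar>min 1 s - min 1 t\<bar> \<le> \<bar>s - t\<bar>" for s t :: real by (auto simp: min_def)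
    then have "\<bar>g k x - g k y\<bar> \<le> \<bar>real k * infdist x (- A) - real k * infdist y (- A)\<bar>"
      by (simp add: g_def)
    also have "\<dots> = real k * \<bar>infdist x (- A) - infdist y (- A)\<bar>"
      by (simp add: abs_mult flip: right_diff_distrib)
    also have "\<dots> \<le> real k * dist x y" by (intro mult_left_mono infdist_triangle_abs) simp
    finally show "dist (g k x) (g k y) \<le> real k * dist x y" by (simp add: dist_real_def)
  qed simp
  have g1: "\<bar>g k q\<bar> \<le> 1" for k q by (auto simp: g_def infdist_nonneg min_def)
  have lim: "(\<lambda>k. g k q) \<longlonglongrightarrow> indicat_real A q" for q
  proof (cases "q \<in> A")
    case True
    then have "infdist q (- A) > 0"
      using A False by (intro infdist_pos_not_in_closed) auto
    then obtain n where n: "1 < real n * infdist q (- A)" using reals_Archimedean3 by blast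
    have "eventually (\<lambda>k. g k q = 1) sequentially"
    proof (rule eventually_sequentiallyI[of n])
      fix k assume "n \<le> k"
      then have "real n * infdist q (- A) \<le> real k * infdist q (- A)"
        by (intro mult_right_mono) (auto simp: infdist_nonneg)
      then show "g k q = 1" using n by (simp add: g_def)
    qed
    then show ?thesis using True by (simp add: tendsto_eventually)
  qed (simp add: g_def infdist_zero)
  have gr: "(\<lambda>t. (t, fst z t, snd z t)) \<in> borel_measurable ?M" if "z \<in> space ?N" for z
    using trajectories_graph_measurable[of "fst z" "snd z"] that by (simp add: trajectories_borel_space)
  have "(\<lambda>z. \<integral>t. indicat_real A (t, fst z t, snd z t) \<partial>?M) \<in> borel_measurable ?N"
  proof (rule borel_measurable_LIMSEQ_real)
    show "(\<lambda>z. \<integral>t. g k (t, fst z t, snd z t) \<partial>?M) \<in> borel_measurable ?N" for k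
      by (rule integral_along_Lipschitz_measurable[OF assms(1,2) lip g1])
    fix z assume z: "z \<in> space ?N"
    show "(\<lambda>k. \<integral>t. g k (t, fst z t, snd z t) \<partial>?M) \<longlonglongrightarrow> (\<integral>t. indicat_real A (t, fst z t, snd z t) \<partial>?M)"
    proof (rule integral_dominated_convergence[where w = "\<lambda>_. 1"])
      show "(\<lambda>t. indicat_real A (t, fst z t, snd z t)) \<in> borel_measurable ?M"
        using A by (intro measurable_compose[OF gr[OF z]]) auto
      show "(\<lambda>t. g k (t, fst z t, snd z t)) \<in> borel_measurable ?M" for k
        using lipschitz_on_continuous_on[OF lip]
        by (intro measurable_compose[OF gr[OF z]] borel_measurable_continuous_onI)
    qed (use lim g1 in auto)
  qed
  then have "(\<lambda>z. ennreal (\<integral>t. indicat_real A (t, fst z t, snd z t) \<partial>?M)) \<in> borel_measurable ?N"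
    by measurable
  moreover have "ennreal (\<integral>t. indicat_real A (t, fst z t, snd z t) \<partial>?M)
      = emeasure ?M {t \<in> {0..T}. (t, fst z t, snd z t) \<in> A}" if z: "z \<in> space ?N" for z
  proof -
    have s: "{t \<in> {0..T}. (t, fst z t, snd z t) \<in> A} \<in> sets ?M"
      using measurable_sets[OF gr[OF z], of A] A by (simp add: vimage_def Int_def conj_commute)
    have "(\<integral>t. indicat_real A (t, fst z t, snd z t) \<partial>?M)
      = (\<integral>t. indicat_real {t \<in> {0..T}. (t, fst z t, snd z t) \<in> A} t \<partial>?M)"
      by (intro Bochner_Integration.integral_cong) (auto simp: indicator_def)
    then show ?thesis using s by (simp add: emeasure_eq_measure Int_absorb2 subset_eq)
  qed
  ultimately show ?thesis by (rule measurable_cong[THEN iffD1, rotated])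
qed simp

section \<open>Occupation measures\<close>

definition state_space :: "real \<Rightarrow> (real^'n) set \<Rightarrow> (real \<times> (real^'d) \<times> (real^'n)) measure" where
  "state_space T U = restrict_space borel ({0..T} \<times> UNIV \<times> U)"

lemma space_state_space: "space (state_space T U) = {0..T} \<times> UNIV \<times> U"
  by (simp add: state_space_def space_restrict_space)

text \<open>Traces of open sets are closed under intersection, so measurability of a kernel need
  only be tested on them.\<close>

lemma sets_state_space_generated:
  "sets (state_space T U) = sigma_sets ({0..T} \<times> UNIV \<times> U) ((\<lambda>A. A \<inter> {0..T} \<times> UNIV \<times> U) ` {A. open A})"
proof -
  let ?X = "{0..T} \<times> UNIV \<times> U"
  have "sets (state_space T U) = {id -` A \<inter> ?X |A. A \<in> sigma_sets UNIV {A. open A}}"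
    by (auto simp: state_space_def sets_restrict_space borel_def Int_commute)
  also have "\<dots> = sigma_sets ?X {id -` A \<inter> ?X |A. A \<in> {A. open A}}"
    by (rule sigma_sets_vimage_commute) simp
  also have "{id -` A \<inter> ?X |A. A \<in> {A. open A}} = (\<lambda>A. A \<inter> ?X) ` {A. open A}"
    by auto
  finally show ?thesis .
qed

text \<open>The control is moved into \<open>U\<close> on the null set of times where it lies outside, so that the graph
  takes its values in the state space even though \<open>U\<close> may fail to be a Borel set.\<close>

definition corrected_graph ::
    "(real^'n) set \<Rightarrow> (real \<Rightarrow> real^'d) \<times> (real \<Rightarrow> real^'n) \<Rightarrow> real \<Rightarrow> real \<times> (real^'d) \<times> (real^'n)" where
  "corrected_graph U z t = (t, fst z t, if snd z t \<in> U then snd z t else (SOME v. v \<in> U))"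

text \<open>Completeness of Lebesgue measure is what makes the correction measurable: the
  exceptional times form a subset of a null set, whatever \<open>U\<close> is.\<close>

lemma
  fixes U :: "(real^'n) set" and z :: "(real \<Rightarrow> real^'d) \<times> (real \<Rightarrow> real^'n)"
  assumes z: "z \<in> trajectories T p U f" and T: "T > 0"
  shows corrected_graph_measurable: "corrected_graph U z \<in> lebesgue_on {0..T} \<rightarrow>\<^sub>M state_space T U"
    and corrected_graph_AE: "AE t in lebesgue_on {0..T}. corrected_graph U z t = (t, fst z t, snd z t)"
proof -
  let ?M = "lebesgue_on {0..T}"
  have zz: "(fst z, snd z) \<in> trajectories T p U f" using z by simp
  have ae: "AE t in ?M. snd z t \<in> U"
    using zz by (auto simp: trajectories_def controls_def)
  obtain N where N: "N \<in> null_sets ?M" "\<And>t. t \<in> {0..T} - N \<Longrightarrow> snd z t \<in> U"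
    using AE_E3[OF ae] by auto
  have negN: "negligible N"
    using N(1) by (simp add: negligible_iff_null_sets null_sets_restrict_space)
  \<comment> \<open>Since \<open>T > 0\<close>, the good times are not exhausted by a null set; one
    of them shows that \<open>U\<close> is nonempty, so the \<open>SOME\<close> lies in
    \<open>U\<close>.\<close>
  have "\<not> negligible {0..T}" using T by (simp add: negligible_iff_null_sets null_sets_def)
  then obtain t where "t \<in> {0..T} - N" using negligible_subset[OF negN] by blast
  then have ne: "(SOME v. v \<in> U) \<in> U" using N(2) someI_ex[of "\<lambda>v. v \<in> U"] by blast
  show aeq: "AE t in ?M. corrected_graph U z t = (t, fst z t, snd z t)"
    using ae by eventually_elim (simp add: corrected_graph_def)
  have gr: "(\<lambda>t. (t, fst z t, snd z t)) \<in> borel_measurable ?M"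
    by (rule trajectories_graph_measurable[OF zz])
  have neg: "negligible {t \<in> {0..T}. snd z t \<notin> U}"
    by (rule negligible_subset[OF negN]) (use N(2) in blast)
  have E: "{t \<in> space ?M. snd z t \<notin> U} \<in> sets ?M"
    using negligible_imp_sets[OF neg] by (subst sets_restrict_space_iff) auto
  have m1: "(\<lambda>t. t) \<in> borel_measurable ?M" "fst z \<in> borel_measurable ?M" "snd z \<in> borel_measurable ?M"
    using measurable_compose[OF gr borel_measurable_continuous_onI[OF continuous_on_fst[OF continuous_on_id]]]
      measurable_compose[OF gr borel_measurable_continuous_onI[OF continuous_on_fst[OF continuous_on_snd[OF continuous_on_id]]]]
      measurable_compose[OF gr borel_measurable_continuous_onI[OF continuous_on_snd[OF continuous_on_snd[OF continuous_on_id]]]]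
    by simp_all
  have "(\<lambda>t. if snd z t \<notin> U then (SOME v. v \<in> U) else snd z t) \<in> borel_measurable ?M"
    using E m1(3) by (intro measurable_If) auto
  also have "(\<lambda>t. if snd z t \<notin> U then (SOME v. v \<in> U) else snd z t) = (\<lambda>t. if snd z t \<in> U then snd z t else (SOME v. v \<in> U))"
    by auto
  finally have "corrected_graph U z \<in> borel_measurable ?M"
    using m1(1,2) unfolding corrected_graph_def[abs_def] by (intro borel_measurable_Pair)
  then show "corrected_graph U z \<in> ?M \<rightarrow>\<^sub>M state_space T U"
    unfolding state_space_def
    by (intro measurable_restrict_space2) (auto simp: corrected_graph_def ne)
qed

text \<open>The law of the point of the graph at a time drawn uniformly from
  \<open>[0,T]\<close>.\<close>

definition trajectory_kernel ::
    "real \<Rightarrow> (real^'n) set \<Rightarrow> (real \<Rightarrow> real^'d) \<times> (real \<Rightarrow> real^'n) \<Rightarrow> (real \<times> (real^'d) \<times> (real^'n)) measure" where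
  "trajectory_kernel T U z =
     distr (scale_measure (ennreal (1 / T)) (lebesgue_on {0..T})) (state_space T U) (corrected_graph U z)"

lemma sets_trajectory_kernel: "sets (trajectory_kernel T U z) = sets (state_space T U)"
  by (simp add: trajectory_kernel_def)

lemma nn_integral_trajectory_kernel:
  fixes U :: "(real^'n) set" and z :: "(real \<Rightarrow> real^'d) \<times> (real \<Rightarrow> real^'n)"
  assumes z: "z \<in> trajectories T p U f" and T: "T > 0" and F: "F \<in> borel_measurable (state_space T U)"
  shows "(\<integral>\<^sup>+q. F q \<partial>trajectory_kernel T U z)
    = ennreal (1 / T) * (\<integral>\<^sup>+t. F (t, fst z t, snd z t) \<partial>lebesgue_on {0..T})"
proof -
  let ?M = "lebesgue_on {0..T}"
  note m = corrected_graph_measurable[OF z T]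
  have m': "corrected_graph U z \<in> scale_measure (ennreal (1 / T)) ?M \<rightarrow>\<^sub>M state_space T U"
    using m by (simp cong: measurable_cong_sets)
  have "(\<integral>\<^sup>+q. F q \<partial>trajectory_kernel T U z) = (\<integral>\<^sup>+t. F (corrected_graph U z t) \<partial>scale_measure (ennreal (1 / T)) ?M)"
    unfolding trajectory_kernel_def by (rule nn_integral_distr[OF m']) (simp add: F)
  also have "\<dots> = ennreal (1 / T) * (\<integral>\<^sup>+t. F (corrected_graph U z t) \<partial>?M)"
    by (rule nn_integral_scale_measure[OF measurable_compose[OF m F]])
  also have "(\<integral>\<^sup>+t. F (corrected_graph U z t) \<partial>?M) = (\<integral>\<^sup>+t. F (t, fst z t, snd z t) \<partial>?M)"
    by (rule nn_integral_cong_AE) (use corrected_graph_AE[OF z T] in eventually_elim, simp)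
  finally show ?thesis .
qed

lemma emeasure_trajectory_kernel_open:
  fixes U :: "(real^'n) set" and z :: "(real \<Rightarrow> real^'d) \<times> (real \<Rightarrow> real^'n)"
  assumes z: "z \<in> trajectories T p U f" and T: "T > 0" and A: "open A"
  shows "emeasure (trajectory_kernel T U z) (A \<inter> {0..T} \<times> UNIV \<times> U)
    = ennreal (1 / T) * emeasure (lebesgue_on {0..T}) {t \<in> {0..T}. (t, fst z t, snd z t) \<in> A}"
proof -
  let ?M = "lebesgue_on {0..T}" and ?X = "{0..T} \<times> UNIV \<times> U"
  have A1: "A \<inter> ?X \<in> sets (state_space T U)"
    unfolding sets_state_space_generated using A by (intro sigma_sets.Basic) auto
  have Am: "A \<in> sets borel" using A by simp
  have A2: "indicator A \<in> borel_measurable (state_space T U)"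
    unfolding state_space_def by (intro measurable_restrict_space1 borel_measurable_indicator Am)
  have "emeasure (trajectory_kernel T U z) (A \<inter> ?X) = (\<integral>\<^sup>+q. indicator (A \<inter> ?X) q \<partial>trajectory_kernel T U z)"
    using A1 by (simp add: sets_trajectory_kernel)
  also have "\<dots> = (\<integral>\<^sup>+q. indicator A q \<partial>trajectory_kernel T U z)"
    by (rule nn_integral_cong)
       (auto simp: sets_eq_imp_space_eq[OF sets_trajectory_kernel] space_state_space indicator_def)
  also have "\<dots> = ennreal (1 / T) * (\<integral>\<^sup>+t. indicator A (t, fst z t, snd z t) \<partial>?M)"
    by (rule nn_integral_trajectory_kernel[OF z T A2])
  also have "(\<integral>\<^sup>+t. indicator A (t, fst z t, snd z t) \<partial>?M)
      = (\<integral>\<^sup>+t. indicator {t \<in> {0..T}. (t, fst z t, snd z t) \<in> A} t \<partial>?M)"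
    by (rule nn_integral_cong) (auto simp: indicator_def)
  also have "\<dots> = emeasure ?M {t \<in> {0..T}. (t, fst z t, snd z t) \<in> A}"
  proof (rule nn_integral_indicator)
    have "(\<lambda>t. (t, fst z t, snd z t)) \<in> borel_measurable ?M"
      using z by (intro trajectories_graph_measurable) simp
    from measurable_sets[OF this Am] show "{t \<in> {0..T}. (t, fst z t, snd z t) \<in> A} \<in> sets ?M"
      by (simp add: vimage_def Int_def conj_commute)
  qed
  finally show ?thesis .
qed

text \<open>On the generator of open traces the kernel is a multiple of the time spent in an open
  set, which is a Borel function of the trajectory.\<close>

lemma trajectory_kernel_measurable:
  fixes U :: "(real^'n) set" and f :: "real^'d \<Rightarrow> real^'n \<Rightarrow> real^'d"
  assumes T: "T > 0" and p: "p \<ge> 1"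
  shows "trajectory_kernel T U \<in> trajectories_borel T p U f \<rightarrow>\<^sub>M subprob_algebra (state_space T U)"
proof (rule measurable_subprob_algebra_generated[OF sets_state_space_generated])
  let ?X = "{0..T} \<times> UNIV \<times> U" and ?M = "lebesgue_on {0..T}"
  let ?G = "(\<lambda>A. A \<inter> ?X) ` {A :: (real \<times> (real^'d) \<times> (real^'n)) set. open A}"
  show "Int_stable ?G"
  proof (rule Int_stableI, clarsimp)
    fix A B :: "(real \<times> (real^'d) \<times> (real^'n)) set" assume "open A" "open B"
    then have "open (A \<inter> B)" by (rule open_Int)
    then show "A \<inter> ?X \<inter> (B \<inter> ?X) \<in> ?G" by (intro image_eqI[of _ _ "A \<inter> B"]) auto
  qed
  show "?G \<subseteq> Pow ?X" by auto
  fix z assume z: "z \<in> space (trajectories_borel T p U f)"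
  show "sets (trajectory_kernel T U z) = sets (state_space T U)" by (rule sets_trajectory_kernel)
  from z have z': "z \<in> trajectories T p U f" by (simp add: trajectories_borel_space)
  show "subprob_space (trajectory_kernel T U z)"
  proof
    have "emeasure (trajectory_kernel T U z) (space (trajectory_kernel T U z))
        = emeasure (trajectory_kernel T U z) (UNIV \<inter> ?X)"
      by (simp add: sets_eq_imp_space_eq[OF sets_trajectory_kernel] space_state_space)
    also have "\<dots> = ennreal (1 / T) * emeasure ?M {0..T}"
      using emeasure_trajectory_kernel_open[OF z' T open_UNIV] by (simp del: atLeastAtMost_iff)
    also have "\<dots> \<le> 1"
      using T by (simp add: emeasure_restrict_space flip: ennreal_mult)
    finally show "emeasure (trajectory_kernel T U z) (space (trajectory_kernel T U z)) \<le> 1" .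
    \<comment> \<open>Any value of the corrected graph, here the one at time 0, is a point of the
      space.\<close>
    show "space (trajectory_kernel T U z) \<noteq> {}"
      using measurable_space[OF corrected_graph_measurable[OF z' T], of 0] T
      by (auto simp: sets_eq_imp_space_eq[OF sets_trajectory_kernel])
  qed
next
  let ?X = "{0..T} \<times> UNIV \<times> U" and ?N = "trajectories_borel T p U f"
  have *: "(\<lambda>z. emeasure (trajectory_kernel T U z) (A \<inter> ?X)) \<in> borel_measurable ?N" if "open A" for A
  proof -
    have "(\<lambda>z. ennreal (1 / T) * emeasure (lebesgue_on {0..T}) {t \<in> {0..T}. (t, fst z t, snd z t) \<in> A})
        \<in> borel_measurable ?N"
      using T by (intro borel_measurable_times_ennreal emeasure_along_open_measurable p that) auto
    then show ?thesis
      by (subst measurable_cong)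
         (auto simp: trajectories_borel_space emeasure_trajectory_kernel_open[OF _ T that])
  qed
  then show "(\<lambda>z. emeasure (trajectory_kernel T U z) A) \<in> borel_measurable ?N"
    if "A \<in> (\<lambda>A. A \<inter> ?X) ` {A. open A}" for A
    using that by auto
  show "(\<lambda>z. emeasure (trajectory_kernel T U z) ?X) \<in> borel_measurable ?N"
    using *[of UNIV] by simp
qed

text \<open>The kernel is normalised to mass \<open>1\<close> because \<open>bind\<close> is meant for subprobability kernels; the factor
  \<open>T\<close> undoes this.\<close>

definition occupation_measure ::
    "real \<Rightarrow> (real^'n) set \<Rightarrow> 'z measure \<Rightarrow> ('z \<Rightarrow> (real \<Rightarrow> real^'d) \<times> (real \<Rightarrow> real^'n))
      \<Rightarrow> (real \<times> (real^'d) \<times> (real^'n)) measure" where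
  "occupation_measure T U M S = scale_measure (ennreal T) (M \<bind> (\<lambda>z. trajectory_kernel T U (S z)))"

section \<open>Integration against the occupation measure\<close>

context
  fixes T p :: real and U :: "(real^'n) set" and f :: "real^'d \<Rightarrow> real^'n \<Rightarrow> real^'d"
    and M :: "'z measure" and S :: "'z \<Rightarrow> (real \<Rightarrow> real^'d) \<times> (real \<Rightarrow> real^'n)"
  assumes T: "T > 0" and p: "p \<ge> 1" and M: "space M \<noteq> {}"
    and S: "S \<in> M \<rightarrow>\<^sub>M trajectories_borel T p U f"
begin

lemma trajectory_kernel_compose_measurable:
  "(\<lambda>z. trajectory_kernel T U (S z)) \<in> M \<rightarrow>\<^sub>M subprob_algebra (state_space T U)"
  by (rule measurable_compose[OF S trajectory_kernel_measurable[OF T p]])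

lemma trajectory_mem: "z \<in> space M \<Longrightarrow> S z \<in> trajectories T p U f"
  using measurable_space[OF S] by (simp add: trajectories_borel_space)

lemma sets_occupation_measure: "sets (occupation_measure T U M S) = sets (state_space T U)"
  using sets_bind_measurable[OF trajectory_kernel_compose_measurable M] by (simp add: occupation_measure_def)

text \<open>The inner integral is \<open>T\<close> times an integral against the kernel, so its
  measurability in \<open>z\<close> is that of the kernel and joint measurability of the controls
  never enters.\<close>

lemma nn_integral_along_measurable:
  assumes F: "F \<in> borel_measurable (state_space T U)"
  shows "(\<lambda>z. \<integral>\<^sup>+t. F (t, fst (S z) t, snd (S z) t) \<partial>lebesgue_on {0..T}) \<in> borel_measurable M"
proof -
  have "(\<lambda>z. ennreal T * (\<integral>\<^sup>+q. F q \<partial>trajectory_kernel T U (S z))) \<in> borel_measurable M"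
    by (intro borel_measurable_times_ennreal borel_measurable_const
        measurable_compose[OF trajectory_kernel_compose_measurable nn_integral_measurable_subprob_algebra[OF F]])
  moreover have "ennreal T * (\<integral>\<^sup>+q. F q \<partial>trajectory_kernel T U (S z))
      = (\<integral>\<^sup>+t. F (t, fst (S z) t, snd (S z) t) \<partial>lebesgue_on {0..T})" if "z \<in> space M" for z
    using T by (simp add: nn_integral_trajectory_kernel[OF trajectory_mem[OF that] T F] flip: mult.assoc ennreal_mult)
  ultimately show ?thesis by (rule measurable_cong[THEN iffD1, rotated])
qed

lemma nn_integral_occupation_measure:
  assumes F: "F \<in> borel_measurable (state_space T U)"
  shows "(\<integral>\<^sup>+q. F q \<partial>occupation_measure T U M S)
    = (\<integral>\<^sup>+z. \<integral>\<^sup>+t. F (t, fst (S z) t, snd (S z) t) \<partial>lebesgue_on {0..T} \<partial>M)"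
proof -
  have sets: "sets (M \<bind> (\<lambda>z. trajectory_kernel T U (S z))) = sets (state_space T U)"
    by (rule sets_bind_measurable[OF trajectory_kernel_compose_measurable M])
  have "(\<integral>\<^sup>+q. F q \<partial>occupation_measure T U M S)
      = ennreal T * (\<integral>\<^sup>+q. F q \<partial>(M \<bind> (\<lambda>z. trajectory_kernel T U (S z))))"
    unfolding occupation_measure_def
    using F sets by (intro nn_integral_scale_measure) (simp cong: measurable_cong_sets)
  also have "\<dots> = ennreal T * (\<integral>\<^sup>+z. \<integral>\<^sup>+q. F q \<partial>trajectory_kernel T U (S z) \<partial>M)"
    by (simp only: nn_integral_bind[OF F trajectory_kernel_compose_measurable])
  also have "\<dots> = ennreal T * (\<integral>\<^sup>+z. ennreal (1 / T) * (\<integral>\<^sup>+t. F (t, fst (S z) t, snd (S z) t) \<partial>lebesgue_on {0..T}) \<partial>M)"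
    by (intro arg_cong[where f = "(*) (ennreal T)"] nn_integral_cong nn_integral_trajectory_kernel[OF trajectory_mem T F])
  also have "\<dots> = (\<integral>\<^sup>+z. \<integral>\<^sup>+t. F (t, fst (S z) t, snd (S z) t) \<partial>lebesgue_on {0..T} \<partial>M)"
    using T by (simp add: nn_integral_cmult[OF nn_integral_along_measurable[OF F]] flip: mult.assoc ennreal_mult)
  finally show ?thesis .
qed

text \<open>Fubini for signed integrands, by splitting into positive and negative parts.
  Measurability of \<open>g\<close> is required for \<open>U = UNIV\<close> because the inner
  Bochner integral follows the uncorrected graph, which may leave \<open>U\<close>.\<close>

lemma
  fixes g :: "real \<times> (real^'d) \<times> (real^'n) \<Rightarrow> real"
  assumes g: "g \<in> borel_measurable (state_space T UNIV)"
    and fin: "(\<integral>\<^sup>+z. \<integral>\<^sup>+t. ennreal \<bar>g (t, fst (S z) t, snd (S z) t)\<bar> \<partial>lebesgue_on {0..T} \<partial>M) < \<infinity>"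
  shows integrable_occupation_measure: "integrable (occupation_measure T U M S) g"
    and integral_along_measurable: "(\<lambda>z. \<integral>t. g (t, fst (S z) t, snd (S z) t) \<partial>lebesgue_on {0..T}) \<in> borel_measurable M"
    and AE_integrable_along: "AE z in M. integrable (lebesgue_on {0..T}) (\<lambda>t. g (t, fst (S z) t, snd (S z) t))"
    and integral_occupation_measure: "(\<integral>q. g q \<partial>occupation_measure T U M S)
      = (\<integral>z. \<integral>t. g (t, fst (S z) t, snd (S z) t) \<partial>lebesgue_on {0..T} \<partial>M)"
proof -
  let ?L = "lebesgue_on {0..T}" and ?g = "\<lambda>z t. g (t, fst (S z) t, snd (S z) t)"
  have gU: "g \<in> borel_measurable (state_space T U)"
    using measurable_restrict_mono[OF g[unfolded state_space_def], of "{0..T} \<times> UNIV \<times> U"]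
    by (auto simp: state_space_def)
  have gm: "?g z \<in> borel_measurable ?L" if z: "z \<in> space M" for z
  proof -
    have "(\<lambda>t. (t, fst (S z) t, snd (S z) t)) \<in> ?L \<rightarrow>\<^sub>M state_space T UNIV"
      unfolding state_space_def
      using trajectories_graph_measurable[of "fst (S z)" "snd (S z)"] trajectory_mem[OF z]
      by (intro measurable_restrict_space2) auto
    from measurable_compose[OF this g] show ?thesis .
  qed
  have nn: "(\<lambda>q. ennreal \<bar>g q\<bar>) \<in> borel_measurable (state_space T U)" "(\<lambda>q. ennreal (g q)) \<in> borel_measurable (state_space T U)"
    "(\<lambda>q. ennreal (- g q)) \<in> borel_measurable (state_space T U)"
    using gU by measurable
  show int: "integrable (occupation_measure T U M S) g"
    unfolding integrable_iff_bounded
  proof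
    show "g \<in> borel_measurable (occupation_measure T U M S)"
      using gU sets_occupation_measure by (simp cong: measurable_cong_sets)
    show "(\<integral>\<^sup>+q. ennreal (norm (g q)) \<partial>occupation_measure T U M S) < \<infinity>"
      using nn_integral_occupation_measure[OF nn(1)] fin by simp
  qed
  define P where "P z = (\<integral>\<^sup>+t. ennreal (?g z t) \<partial>?L)" for z
  define Q where "Q z = (\<integral>\<^sup>+t. ennreal (- ?g z t) \<partial>?L)" for z
  have "AE z in M. (\<integral>\<^sup>+t. ennreal \<bar>?g z t\<bar> \<partial>?L) \<noteq> \<infinity>"
    using fin by (intro nn_integral_PInf_AE nn_integral_along_measurable[OF nn(1)]) simp
  then show ae: "AE z in M. integrable ?L (?g z)"
    using AE_space by eventually_elim (auto simp: integrable_iff_bounded gm less_top)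
  have Pm: "P \<in> borel_measurable M" "Q \<in> borel_measurable M"
    unfolding P_def[abs_def] Q_def[abs_def] by (intro nn_integral_along_measurable nn(2,3))+
  have "(\<integral>\<^sup>+z. P z \<partial>M) \<le> (\<integral>\<^sup>+z. \<integral>\<^sup>+t. ennreal \<bar>?g z t\<bar> \<partial>?L \<partial>M)"
    "(\<integral>\<^sup>+z. Q z \<partial>M) \<le> (\<integral>\<^sup>+z. \<integral>\<^sup>+t. ennreal \<bar>?g z t\<bar> \<partial>?L \<partial>M)"
    unfolding P_def Q_def by (intro nn_integral_mono ennreal_leI, simp)+
  then have fPQ: "(\<integral>\<^sup>+z. P z \<partial>M) < \<infinity>" "(\<integral>\<^sup>+z. Q z \<partial>M) < \<infinity>"
    using fin by (auto intro: le_less_trans)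
  \<comment> \<open>A finite integral forces finite values almost everywhere, so replacing infinite
    values by 0 through \<open>enn2real\<close> changes nothing.\<close>
  have rep: "integrable M (\<lambda>z. enn2real (R z)) \<and> (\<integral>z. enn2real (R z) \<partial>M) = enn2real (\<integral>\<^sup>+z. R z \<partial>M)"
    if R: "R \<in> borel_measurable M" "(\<integral>\<^sup>+z. R z \<partial>M) < \<infinity>" for R :: "'z \<Rightarrow> ennreal"
  proof -
    have "AE z in M. R z \<noteq> \<infinity>" using R by (intro nn_integral_PInf_AE) auto
    then have eq: "(\<integral>\<^sup>+z. ennreal (enn2real (R z)) \<partial>M) = (\<integral>\<^sup>+z. R z \<partial>M)"
      by (intro nn_integral_cong_AE) (elim eventually_mono, simp add: less_top)
    have m: "(\<lambda>z. enn2real (R z)) \<in> borel_measurable M" using R by measurable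
    have "integrable M (\<lambda>z. enn2real (R z))"
      using m eq R by (intro integrableI_nonneg) auto
    moreover have "(\<integral>z. enn2real (R z) \<partial>M) = enn2real (\<integral>\<^sup>+z. ennreal (enn2real (R z)) \<partial>M)"
      using m by (intro integral_eq_nn_integral) auto
    ultimately show ?thesis using eq by simp
  qed
  show m: "(\<lambda>z. \<integral>t. ?g z t \<partial>?L) \<in> borel_measurable M"
  proof -
    define R where "R z = (\<integral>\<^sup>+t. ennreal \<bar>?g z t\<bar> \<partial>?L)" for z
    have [measurable]: "P \<in> borel_measurable M" "Q \<in> borel_measurable M" "R \<in> borel_measurable M"
      using Pm nn_integral_along_measurable[OF nn(1)] by (auto simp: R_def[abs_def])
    \<comment> \<open>The Bochner integral is 0 where the integrand is not integrable, that is where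
      \<open>R z\<close> is infinite. The case distinction thus reproduces it at every
      \<open>z\<close>, not only almost everywhere, which matters as \<open>M\<close> need not be
      complete.\<close>
    have "(\<lambda>z. if R z < \<infinity> then enn2real (P z) - enn2real (Q z) else 0) \<in> borel_measurable M"
      by measurable
    moreover have "(if R z < \<infinity> then enn2real (P z) - enn2real (Q z) else 0) = (\<integral>t. ?g z t \<partial>?L)"
      if z: "z \<in> space M" for z
    proof -
      have "integrable ?L (?g z) \<longleftrightarrow> R z < \<infinity>"
        by (simp add: integrable_iff_bounded gm[OF z] R_def)
      then show ?thesis
        by (auto simp: real_lebesgue_integral_def P_def Q_def not_integrable_integral_eq)
    qed
    ultimately show ?thesis by (rule measurable_cong[THEN iffD1, rotated])
  qed
  have "(\<integral>q. g q \<partial>occupation_measure T U M S) = enn2real (\<integral>\<^sup>+z. P z \<partial>M) - enn2real (\<integral>\<^sup>+z. Q z \<partial>M)"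
    unfolding real_lebesgue_integral_def[OF int] P_def Q_def
    by (simp only: nn_integral_occupation_measure[OF nn(2)] nn_integral_occupation_measure[OF nn(3)])
  also have "\<dots> = (\<integral>z. enn2real (P z) - enn2real (Q z) \<partial>M)"
    using rep[OF Pm(1) fPQ(1)] rep[OF Pm(2) fPQ(2)] by (simp add: Bochner_Integration.integral_diff)
  also have "\<dots> = (\<integral>z. \<integral>t. ?g z t \<partial>?L \<partial>M)"
  proof -
    have eq: "AE z in M. enn2real (P z) - enn2real (Q z) = (\<integral>t. ?g z t \<partial>?L)"
      using ae by eventually_elim (simp add: real_lebesgue_integral_def P_def Q_def)
    show ?thesis using Pm by (intro integral_cong_AE eq m borel_measurable_diff borel_measurable_enn2real)
  qed
  finally show "(\<integral>q. g q \<partial>occupation_measure T U M S) = (\<integral>z. \<integral>t. ?g z t \<partial>?L \<partial>M)" .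
qed

end

section \<open>The transport equation\<close>

lemma smooth_imp_continuous_on: "smooth g \<Longrightarrow> continuous_on UNIV g"
  unfolding smooth_def by (metis Ck.simps(1))

lemma continuous_on_control_field:
  fixes f0 :: "real^'d \<Rightarrow> real^'d" and fs :: "'n::finite \<Rightarrow> real^'d \<Rightarrow> real^'d"
  assumes "continuous_on UNIV f0" "\<And>i. continuous_on UNIV (fs i)"
  shows "continuous_on UNIV (\<lambda>(x, u). control_field f0 fs x u)"
proof -
  have "continuous_on UNIV (\<lambda>q :: (real^'d) \<times> (real^'n). f0 (fst q) + (\<Sum>i\<in>UNIV. (snd q $ i) *\<^sub>R fs i (fst q)))"
    by (intro continuous_intros continuous_on_compose2[OF assms(1)] continuous_on_compose2[OF assms(2)]) auto
  then show ?thesis by (simp add: control_field_def split_def)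
qed

text \<open>The direction \<open>f x u\<close> varies with the point, while \<open>C1c\<close> gives
  continuity for fixed directions only. Expanding \<open>f x u\<close> in the standard basis reduces
  to fixed directions with continuous coefficients.\<close>

lemma transport_integrand_measurable:
  fixes f :: "real^'d \<Rightarrow> real^'n \<Rightarrow> real^'d"
  assumes \<phi>: "\<phi> \<in> C1c T" and f: "continuous_on UNIV (\<lambda>(x, u). f x u)"
  shows "transport_integrand T f \<phi> \<in> borel_measurable (state_space T UNIV)"
proof -
  let ?X = "{0..T} \<times> UNIV :: (real \<times> (real^'d)) set" and ?Y = "{0..T} \<times> UNIV \<times> UNIV :: (real \<times> (real^'d) \<times> (real^'n)) set"
  have d: "continuous_on ?Y (\<lambda>q. dtest T \<phi> (fst q, fst (snd q)) v)" for v
  proof -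
    have "continuous_on ?X (\<lambda>q. dtest T \<phi> q v)" using \<phi> unfolding C1c_def by blast
    then show ?thesis
      by (rule continuous_on_compose2) (auto intro!: continuous_intros)
  qed
  have "continuous_on ?Y (\<lambda>q. (\<lambda>(x, u). f x u) (snd q))"
    by (rule continuous_on_compose2[OF f]) (auto intro!: continuous_intros)
  then have fc: "continuous_on ?Y (\<lambda>q. f (fst (snd q)) (snd (snd q)))"
    by (simp add: split_def)
  have eq: "transport_integrand T f \<phi> q = dtest T \<phi> (fst q, fst (snd q)) (1, 0)
      + (\<Sum>i\<in>UNIV. (f (fst (snd q)) (snd (snd q)) $ i) * dtest T \<phi> (fst q, fst (snd q)) (0, axis i 1))"
    if "q \<in> ?Y" for q
  proof -
    define D where "D = dtest T \<phi> (fst q, fst (snd q))"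
    define w where "w = f (fst (snd q)) (snd (snd q))"
    have "(fst q, fst (snd q)) \<in> ?X" using that by (simp add: mem_Times_iff)
    then have lin: "linear D" unfolding D_def by (rule C1c_linear_dtest[OF \<phi>])
    have lin2: "linear (\<lambda>v. D (0, v))"
    proof (rule linearI)
      show "D (0, v + w) = D (0, v) + D (0, w)" for v w
        using linear_add[OF lin, of "(0, v)" "(0, w)"] by simp
      show "D (0, c *\<^sub>R v) = c *\<^sub>R D (0, v)" for c v
        using linear_cmul[OF lin, of c "(0, v)"] by simp
    qed
    have "w = (\<Sum>i\<in>UNIV. (w $ i) *\<^sub>R axis i 1)"
      using basis_expansion[of w] by (simp add: scalar_mult_eq_scaleR)
    then have "D (0, w) = D (0, \<Sum>i\<in>UNIV. (w $ i) *\<^sub>R axis i 1)" by (rule arg_cong)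
    also have "\<dots> = (\<Sum>i\<in>UNIV. (w $ i) * D (0, axis i 1))"
      by (simp only: linear_sum[OF lin2] linear_cmul[OF lin2] real_scaleR_def)
    finally have "D (0, w) = \<dots>" .
    then show ?thesis by (simp add: transport_integrand_def split_def D_def w_def)
  qed
  have "continuous_on ?Y (transport_integrand T f \<phi>)"
    by (subst continuous_on_cong[OF refl eq], assumption) (intro continuous_intros d fc)
  then show ?thesis
    unfolding state_space_def by (rule borel_measurable_continuous_on_restrict)
qed

lemma C1c_slice_continuous:
  assumes "\<phi> \<in> C1c T" "t \<in> {0..T}"
  shows "continuous_on UNIV (\<lambda>x. \<phi> (t, x))"
proof -
  have "continuous_on ({0..T} \<times> UNIV) \<phi>"
    using assms(1) by (auto simp: C1c_def intro: differentiable_imp_continuous_on)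
  then show ?thesis
    by (rule continuous_on_compose2) (use assms(2) in \<open>auto intro!: continuous_intros\<close>)
qed

text \<open>The strip is closed, so the closure of the support stays inside it, where
  \<open>\<phi>\<close> is continuous; compactness then bounds \<open>\<phi>\<close>.\<close>

lemma C1c_bounded:
  fixes \<phi> :: "real \<times> (real^'d) \<Rightarrow> real"
  assumes "\<phi> \<in> C1c T"
  obtains B where "\<And>q. q \<in> {0..T} \<times> UNIV \<Longrightarrow> \<bar>\<phi> q\<bar> \<le> B"
proof -
  let ?X = "{0..T} \<times> UNIV :: (real \<times> (real^'d)) set"
  let ?C = "closure {q \<in> ?X. \<phi> q \<noteq> 0}"
  have "closed ?X" by (intro closed_Times) auto
  then have CX: "?C \<subseteq> ?X" by (intro closure_minimal) auto
  have "continuous_on ?X \<phi>"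
    using assms by (auto simp: C1c_def intro: differentiable_imp_continuous_on)
  then have "compact (\<phi> ` ?C)"
    using assms CX by (intro compact_continuous_image) (auto simp: C1c_def intro: continuous_on_subset)
  then obtain B where B: "\<And>q. q \<in> ?C \<Longrightarrow> \<bar>\<phi> q\<bar> \<le> B"
    using compact_imp_bounded[of "\<phi> ` ?C"] unfolding bounded_iff by auto
  \<comment> \<open>If the support is empty, \<open>B\<close> may be negative.\<close>
  have "\<bar>\<phi> q\<bar> \<le> max B 0" if "q \<in> ?X" for q
  proof (cases "\<phi> q = 0")
    case False
    with that have "q \<in> {q \<in> ?X. \<phi> q \<noteq> 0}" by simp
    with closure_subset have "q \<in> ?C" by (rule subsetD)
    then have "\<bar>\<phi> q\<bar> \<le> B" by (rule B)
    then show ?thesis by simp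
  qed simp
  then show thesis by (rule that)
qed

text \<open>The time coordinate of every graph is \<open>t\<close> itself, so the time marginal is
  the same for all \<open>z\<close>, and averaging over a probability measure leaves it
  unchanged.\<close>

lemma occupation_measure_young:
  fixes U :: "(real^'n) set" and f :: "real^'d \<Rightarrow> real^'n \<Rightarrow> real^'d"
    and S :: "'z \<Rightarrow> (real \<Rightarrow> real^'d) \<times> (real \<Rightarrow> real^'n)"
  assumes "T > 0" "p \<ge> 1" "prob_space M" and S: "S \<in> M \<rightarrow>\<^sub>M trajectories_borel T p U f"
  shows "occupation_measure T U M S \<in> young_measures T U"
proof -
  interpret prob_space M by fact
  let ?\<eta> = "occupation_measure T U M S"
  note sets_\<eta> = sets_occupation_measure[OF assms(1,2) not_empty S]
  note nn_\<eta> = nn_integral_occupation_measure[OF assms(1,2) not_empty S]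
  have fst_m: "fst \<in> state_space T U \<rightarrow>\<^sub>M restrict_space borel {0..T}"
    unfolding state_space_def
    using borel_measurable_continuous_onI[OF continuous_on_fst[OF continuous_on_id]]
    by (intro measurable_restrict_space3) auto
  have fst_\<eta>: "fst \<in> ?\<eta> \<rightarrow>\<^sub>M restrict_space borel {0..T}"
    using fst_m sets_\<eta> by (simp cong: measurable_cong_sets)
  have "distr ?\<eta> (restrict_space borel {0..T}) fst = restrict_space lborel {0..T}"
  proof (rule measure_eqI)
    show "sets (distr ?\<eta> (restrict_space borel {0..T}) fst) = sets (restrict_space lborel {0..T})"
      by (simp add: sets_restrict_space)
    fix B assume "B \<in> sets (distr ?\<eta> (restrict_space borel {0..T}) fst)"
    then have B: "B \<in> sets (restrict_space borel {0..T})" by simp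
    then have B': "B \<in> sets borel" "B \<subseteq> {0..T}" by (auto simp: sets_restrict_space_iff)
    have ind: "(\<lambda>q. indicator B (fst q) :: ennreal) \<in> borel_measurable (state_space T U)"
      by (rule measurable_compose[OF fst_m]) (use B in simp)
    have "emeasure (distr ?\<eta> (restrict_space borel {0..T}) fst) B
        = (\<integral>\<^sup>+s. indicator B s \<partial>distr ?\<eta> (restrict_space borel {0..T}) fst)"
      using B by simp
    also have "\<dots> = (\<integral>\<^sup>+q. indicator B (fst q) \<partial>?\<eta>)"
      using B by (intro nn_integral_distr[OF fst_\<eta>]) simp
    also have "\<dots> = (\<integral>\<^sup>+z. \<integral>\<^sup>+t. indicator B t \<partial>lebesgue_on {0..T} \<partial>M)"
      by (simp add: nn_\<eta>[OF ind])
    also have "(\<integral>\<^sup>+t. indicator B t \<partial>lebesgue_on {0..T}) = emeasure (lebesgue_on {0..T}) B"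
      using B' by (intro nn_integral_indicator) (auto simp: sets_restrict_space_iff)
    also have "(\<integral>\<^sup>+z. emeasure (lebesgue_on {0..T}) B \<partial>M) = emeasure (lebesgue_on {0..T}) B"
      by (simp add: emeasure_space_1)
    also have "\<dots> = emeasure (restrict_space lborel {0..T}) B"
      using B' by (simp add: emeasure_restrict_space)
    finally show "emeasure (distr ?\<eta> (restrict_space borel {0..T}) fst) B = emeasure (restrict_space lborel {0..T}) B" .
  qed
  then show ?thesis using sets_\<eta> by (simp add: young_measures_def state_space_def)
qed

theorem proposition3p4:
  fixes T p :: real
    and U :: "(real^'n) set"
    and f0 :: "real^'d \<Rightarrow> real^'d"
    and fs :: "'n \<Rightarrow> real^'d \<Rightarrow> real^'d"
    and \<mu>0 \<mu>T :: "(real^'d) measure"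
    and \<gamma> :: "((real^'d) \<times> (real^'d)) measure"
    and D :: "((real^'d) \<times> (real^'d)) set"
    and S :: "(real^'d) \<times> (real^'d) \<Rightarrow> (real \<Rightarrow> real^'d) \<times> (real \<Rightarrow> real^'n)"
  defines "f \<equiv> control_field f0 fs"
  assumes "T > 0" and "p \<ge> 1"
    and "smooth f0" and "\<And>i. smooth (fs i)"
    and "\<mu>0 \<in> borel_probs" and "\<mu>T \<in> borel_probs"
    and "\<gamma> \<in> couplings \<mu>0 \<mu>T"
    and "D \<in> sets borel" and "AE z in \<gamma>. z \<in> D"
    and "S \<in> restrict_space borel D \<rightarrow>\<^sub>M trajectories_borel T p U f"
    and "AE z in \<gamma>. state_at S 0 z = fst z \<and> state_at S T z = snd z"
    and "transport_integrable_along T f \<gamma> D S"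
  shows "\<exists>\<eta>. \<eta> \<in> admissible_young_measures T U f \<mu>0 \<mu>T"
proof -
  have \<gamma>: "prob_space \<gamma>" and s\<gamma>: "sets \<gamma> = sets borel"
    and \<mu>0: "\<mu>0 = distr \<gamma> borel fst" and \<mu>T: "\<mu>T = distr \<gamma> borel snd"
    using \<open>\<gamma> \<in> couplings \<mu>0 \<mu>T\<close> by (auto simp: couplings_def borel_probs_def)
  interpret \<gamma>: prob_space \<gamma> by fact
  have D: "D \<inter> space \<gamma> \<in> sets \<gamma>" and sp\<gamma>: "space \<gamma> = UNIV"
    using \<open>D \<in> sets borel\<close> s\<gamma> sets_eq_imp_space_eq[OF s\<gamma>] by auto
  \<comment> \<open>On \<open>D\<close> the map \<open>S\<close> is defined everywhere; as
    \<open>D\<close> has full measure, \<open>M\<close> is still a probability measure.\<close>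
  define M where "M = restrict_space \<gamma> D"
  have spM: "space M = D" by (simp add: M_def space_restrict_space sp\<gamma>)
  have M: "prob_space M"
  proof
    have "emeasure M (space M) = emeasure \<gamma> D"
      unfolding spM using D by (simp add: M_def emeasure_restrict_space sp\<gamma>)
    also have "\<dots> = 1"
      using \<gamma>.emeasure_eq_1_AE[of D] D sp\<gamma> \<open>AE z in \<gamma>. z \<in> D\<close> by simp
    finally show "emeasure M (space M) = 1" .
  qed
  interpret M: prob_space M by fact
  have S: "S \<in> M \<rightarrow>\<^sub>M trajectories_borel T p U f"
    using \<open>S \<in> restrict_space borel D \<rightarrow>\<^sub>M _\<close> unfolding M_def
    by (simp cong: measurable_cong_sets add: measurable_cong_sets[OF sets_restrict_space_cong[OF s\<gamma>] refl])
  have fc: "continuous_on UNIV (\<lambda>(x, u). f x u)"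
    unfolding f_def using assms(4,5) by (intro continuous_on_control_field smooth_imp_continuous_on)
  let ?\<eta> = "occupation_measure T U M S"
  note occ = \<open>T > 0\<close> \<open>p \<ge> 1\<close> M.not_empty S
  have "integrable ?\<eta> (transport_integrand T f \<phi>) \<and>
      (\<integral>y. transport_integrand T f \<phi> y \<partial>?\<eta>) = (\<integral>x. \<phi> (T, x) \<partial>\<mu>T) - (\<integral>x. \<phi> (0, x) \<partial>\<mu>0)"
    if \<phi>: "\<phi> \<in> C1c T" for \<phi>
  proof
    note g = transport_integrand_measurable[OF \<phi> fc]
    have fin: "(\<integral>\<^sup>+z. \<integral>\<^sup>+t. ennreal \<bar>transport_integrand T f \<phi> (t, state_at S t z, control_at S t z)\<bar>
        \<partial>lebesgue_on {0..T} \<partial>M) < \<infinity>"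
      using \<open>transport_integrable_along T f \<gamma> D S\<close> \<phi>
      by (simp add: transport_integrable_along_def M_def nn_integral_restrict_space[OF D])
    show "integrable ?\<eta> (transport_integrand T f \<phi>)"
      by (rule integrable_occupation_measure[OF occ g fin])
    obtain B where B: "\<And>q. q \<in> {0..T} \<times> UNIV \<Longrightarrow> \<bar>\<phi> q\<bar> \<le> B"
      using C1c_bounded[OF \<phi>] by blast
    have m\<phi>: "(\<lambda>x. \<phi> (0, x)) \<in> borel_measurable borel" "(\<lambda>x. \<phi> (T, x)) \<in> borel_measurable borel"
      using C1c_slice_continuous[OF \<phi>] \<open>T > 0\<close> by (auto intro!: borel_measurable_continuous_onI)
    have mfs: "fst \<in> borel_measurable \<gamma>" "snd \<in> borel_measurable \<gamma>"
      using borel_measurable_continuous_onI[OF continuous_on_fst[OF continuous_on_id]]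
        borel_measurable_continuous_onI[OF continuous_on_snd[OF continuous_on_id]]
      by (simp_all add: measurable_cong_sets[OF s\<gamma> refl])
    have m\<gamma>: "(\<lambda>z. \<phi> (T, snd z)) \<in> borel_measurable \<gamma>" "(\<lambda>z. \<phi> (0, fst z)) \<in> borel_measurable \<gamma>"
      by (rule measurable_compose[OF mfs(2) m\<phi>(2)], rule measurable_compose[OF mfs(1) m\<phi>(1)])
    have i\<gamma>: "integrable \<gamma> (\<lambda>z. \<phi> (T, snd z))" "integrable \<gamma> (\<lambda>z. \<phi> (0, fst z))"
      using m\<gamma> B \<open>T > 0\<close> by (auto intro!: \<gamma>.integrable_const_bound[of _ B])
    have ends: "AE z in M. state_at S 0 z = fst z \<and> state_at S T z = snd z"
      using assms(12) unfolding M_def by (subst AE_restrict_space_iff[OF D]) auto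
    have ae: "AE z in M. (\<integral>t. transport_integrand T f \<phi> (t, state_at S t z, control_at S t z) \<partial>lebesgue_on {0..T})
        = \<phi> (T, snd z) - \<phi> (0, fst z)"
      using AE_integrable_along[OF occ g fin] ends AE_space
    proof eventually_elim
      case (elim z)
      have "(fst (S z), snd (S z)) \<in> trajectories T p U f"
        using trajectory_mem[OF occ elim(3)] by simp
      from integral_transport_integrand_along[OF \<open>T > 0\<close> \<phi> this elim(1)] elim(2)
      show ?case by simp
    qed
    have "(\<integral>y. transport_integrand T f \<phi> y \<partial>?\<eta>)
      = (\<integral>z. \<integral>t. transport_integrand T f \<phi> (t, state_at S t z, control_at S t z) \<partial>lebesgue_on {0..T} \<partial>M)"
      by (rule integral_occupation_measure[OF occ g fin])
    also have "\<dots> = (\<integral>z. \<phi> (T, snd z) - \<phi> (0, fst z) \<partial>M)"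
    proof (rule integral_cong_AE[OF integral_along_measurable[OF occ g fin] _ ae])
      show "(\<lambda>z. \<phi> (T, snd z) - \<phi> (0, fst z)) \<in> borel_measurable M"
        unfolding M_def by (intro measurable_restrict_space1 borel_measurable_diff m\<gamma>)
    qed
    also have "\<dots> = (\<integral>z. indicat_real D z *\<^sub>R (\<phi> (T, snd z) - \<phi> (0, fst z)) \<partial>\<gamma>)"
      unfolding M_def by (rule integral_restrict_space[OF D])
    \<comment> \<open>Back from \<open>M\<close> to \<open>\<gamma>\<close>, whose marginals are the
      prescribed ones.\<close>
    also have "\<dots> = (\<integral>z. \<phi> (T, snd z) - \<phi> (0, fst z) \<partial>\<gamma>)"
    proof (rule integral_cong_AE)
      show "AE z in \<gamma>. indicat_real D z *\<^sub>R (\<phi> (T, snd z) - \<phi> (0, fst z)) = \<phi> (T, snd z) - \<phi> (0, fst z)"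
        using \<open>AE z in \<gamma>. z \<in> D\<close> by eventually_elim simp
      show "(\<lambda>z. indicat_real D z *\<^sub>R (\<phi> (T, snd z) - \<phi> (0, fst z))) \<in> borel_measurable \<gamma>"
        using m\<gamma> D sp\<gamma> by (intro borel_measurable_scaleR borel_measurable_diff borel_measurable_indicator) auto
    qed (intro borel_measurable_diff m\<gamma>)
    also have "\<dots> = (\<integral>z. \<phi> (T, snd z) \<partial>\<gamma>) - (\<integral>z. \<phi> (0, fst z) \<partial>\<gamma>)"
      by (rule Bochner_Integration.integral_diff[OF i\<gamma>])
    also have "\<dots> = (\<integral>x. \<phi> (T, x) \<partial>\<mu>T) - (\<integral>x. \<phi> (0, x) \<partial>\<mu>0)"
      unfolding \<mu>0 \<mu>T by (simp only: integral_distr[OF mfs(2) m\<phi>(2)] integral_distr[OF mfs(1) m\<phi>(1)])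
    finally show "(\<integral>y. transport_integrand T f \<phi> y \<partial>?\<eta>) = (\<integral>x. \<phi> (T, x) \<partial>\<mu>T) - (\<integral>x. \<phi> (0, x) \<partial>\<mu>0)" .
  qed
  then have "?\<eta> \<in> admissible_young_measures T U f \<mu>0 \<mu>T"
    using occupation_measure_young[OF \<open>T > 0\<close> \<open>p \<ge> 1\<close> M S] by (simp add: admissible_young_measures_def)
  then show ?thesis by blast
qed

end
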